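(* Let $\nu$ be a non-zero finite Borel measure on $(0,1)$. If the Minkowski dimension of $\operatorname{supp}\nu$ exists, i.e. $\overline{\dim}_M(\operatorname{supp}\nu)=\underline{\dim}_M(\operatorname{supp}\nu)$, and $-\partial\beta_\nu(0)=[a,b]$ with real numbers $a\le b$, then $$\frac{\delta_\nu^*}{1+b}\le\underline s_\nu .$$
   Context: $\Lambda$ is Lebesgue measure. $\delta_\nu^*:=\overline{\dim}_M(\operatorname{supp}\nu)$ is the upper Minkowski dimension of the support of $\nu$. For $n\in\mathbb N$ and $0\le k<2^n$ let $A^n_k:=(k2^{-n},(k+1)2^{-n}]$ and $\mathcal D_{\nu,n}:=\{A^n_k:\nu(A^n_k)>0\}$. For $q\in\mathbb R$ put $\beta^\nu_n(q):=\frac{1}{\log 2^n}\log\sum_{C\in\mathcal D_{\nu,n}}\nu(C)^q$ and $\beta_\nu(q):=\limsup_{n\to\infty}\beta_n^\nu(q)$ (possibly $+\infty$ for $q<0$). The subdifferential is $\partial\beta_\nu(q):=\{c\in\mathbb R:\ \beta_\nu(t)\ge c(t-q)+\beta_\nu(q)\ \text{for all }t\in\mathbb R\}$, and $-\partial\beta_\nu(q)=\{-c:c\in\partial\beta_\nu(q)\}$. Lower spectral dimension. $\nu$ is regarded as a measure on $[0,1]$. $H^1_0(0,1)$ is the space of functions $f:[0,1]\to\mathbb R$ with $f(x)=\int_{[0,x]}g\,d\Lambda$ for some $g\in L^2_\Lambda([0,1])$ and $f(0)=f(1)=0$; $\nabla_\Lambda f:=g$. $C_\nu([0,1])$ is the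 set of continuous real functions on $[0,1]$ that are affine linear on every connected component of $[0,1]\setminus\operatorname{supp}\nu$. $\operatorname{dom}(\mathcal E_\nu):=H^1_0(0,1)\cap C_\nu([0,1])$, $\mathcal E_\nu(f,g):=\int_{(0,1)}\nabla_\Lambda f\,\nabla_\Lambda g\,d\Lambda$. A number $\lambda$ is an eigenvalue of $\mathcal E_\nu$ if there is $f\in\operatorname{dom}(\mathcal E_\nu)\setminus\{0\}$ with $\mathcal E_\nu(f,g)=\lambda\int fg\,d\nu$ for all $g\in\operatorname{dom}(\mathcal E_\nu)$. $N_\nu(x)$ is the number of eigenvalues $\le x$ (with multiplicity). $\underline{s}_\nu:=\liminf_{x\to\infty}\frac{\log N_\nu(x)}{\log x}$. *)

theory Defs
  imports "HOL-Analysis.Analysis" "HOL-Library.Function_Algebras"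
begin

(* A Borel measure on (0,1) is a measure on the Borel sets of the real line that gives no mass to
   the complement of (0,1); this also covers its reading as a measure on [0,1].  In particular
   the support is taken in the line and may contain 0 or 1. *)
definition borel_measure_on_unit :: "real measure \<Rightarrow> bool" where
  "borel_measure_on_unit \<nu> \<longleftrightarrow> sets \<nu> = sets borel \<and> emeasure \<nu> (- {0<..<1}) = 0"

definition measure_support :: "'a::topological_space measure \<Rightarrow> 'a set" where
  "measure_support \<nu> = {x. \<forall>U. open U \<longrightarrow> x \<in> U \<longrightarrow> emeasure \<nu> U > 0}"


subsection \<open>Minkowski dimension\<close>

(* Only meaningful for r > 0 and totally bounded A, where finite covers exist. *)
definition covering_number :: "'a::metric_space set \<Rightarrow> real \<Rightarrow> nat" where
  "covering_number A r = (LEAST n. \<exists>F. finite F \<and> card F = n \<and> A \<subseteq> (\<Union>x\<in>F. cball x r))"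

definition upper_minkowski_dim :: "'a::metric_space set \<Rightarrow> ereal" where
  "upper_minkowski_dim A =
     Limsup (at_right 0) (\<lambda>r. ereal (ln (real (covering_number A r)) / ln (1 / r)))"

definition lower_minkowski_dim :: "'a::metric_space set \<Rightarrow> ereal" where
  "lower_minkowski_dim A =
     Liminf (at_right 0) (\<lambda>r. ereal (ln (real (covering_number A r)) / ln (1 / r)))"


subsection \<open>The \<open>L\<^sup>q\<close>-spectrum and its subdifferential\<close>

definition dyadic_interval :: "nat \<Rightarrow> nat \<Rightarrow> real set" where
  "dyadic_interval n k = {real k / 2 ^ n <.. (real k + 1) / 2 ^ n}"

definition charged_dyadics :: "real measure \<Rightarrow> nat \<Rightarrow> real set set" where
  "charged_dyadics \<nu> n =
     {dyadic_interval n k | k. k < 2 ^ n \<and> measure \<nu> (dyadic_interval n k) > 0}"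

definition Lq_level :: "real measure \<Rightarrow> nat \<Rightarrow> real \<Rightarrow> real" where
  "Lq_level \<nu> n q = (1 / ln (2 ^ n)) * ln (\<Sum>C\<in>charged_dyadics \<nu> n. measure \<nu> C powr q)"

definition Lq_spectrum :: "real measure \<Rightarrow> real \<Rightarrow> ereal" where
  "Lq_spectrum \<nu> q = limsup (\<lambda>n. ereal (Lq_level \<nu> n q))"

definition subdifferential :: "(real \<Rightarrow> ereal) \<Rightarrow> real \<Rightarrow> real set" where
  "subdifferential \<beta> q = {c. \<forall>t. \<beta> t \<ge> ereal (c * (t - q)) + \<beta> q}"


subsection \<open>The Dirichlet form and its eigenvalues\<close>

definition is_weak_gradient :: "(real \<Rightarrow> real) \<Rightarrow> (real \<Rightarrow> real) \<Rightarrow> bool" where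
  "is_weak_gradient f g \<longleftrightarrow>
     set_borel_measurable lborel {0..1} g \<and>
     set_integrable lborel {0..1} (\<lambda>x. (g x)\<^sup>2) \<and>
     (\<forall>x\<in>{0..1}. f x = (LINT t:{0..x}|lborel. g t))"

(* Functions on [0,1] are represented by their extension by zero to the line, so that equality of
   functions, and hence linear independence, is that of functions on [0,1]. *)
definition H10 :: "(real \<Rightarrow> real) set" where
  "H10 = {f. (\<forall>x. x \<notin> {0..1} \<longrightarrow> f x = 0) \<and> (\<exists>g. is_weak_gradient f g) \<and> f 0 = 0 \<and> f 1 = 0}"

(* A representative; the gradient is determined by f only up to Lebesgue null sets. *)
definition weak_gradient :: "(real \<Rightarrow> real) \<Rightarrow> real \<Rightarrow> real" where
  "weak_gradient f = (SOME g. is_weak_gradient f g)"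

definition C_affine_off_support :: "real measure \<Rightarrow> (real \<Rightarrow> real) set" where
  "C_affine_off_support \<nu> =
     {f. continuous_on {0..1} f \<and>
         (\<forall>I\<in>components ({0..1} - measure_support \<nu>). \<exists>m d. \<forall>x\<in>I. f x = m * x + d)}"

definition dom_form :: "real measure \<Rightarrow> (real \<Rightarrow> real) set" where
  "dom_form \<nu> = H10 \<inter> C_affine_off_support \<nu>"

definition dirichlet_form :: "(real \<Rightarrow> real) \<Rightarrow> (real \<Rightarrow> real) \<Rightarrow> real" where
  "dirichlet_form f g = (LINT x:{0<..<1}|lborel. weak_gradient f x * weak_gradient g x)"

definition eigenspace :: "real measure \<Rightarrow> real \<Rightarrow> (real \<Rightarrow> real) set" where
  "eigenspace \<nu> lam =
     {f \<in> dom_form \<nu>. \<forall>g\<in>dom_form \<nu>. dirichlet_form f g = lam * (LINT x|\<nu>. f x * g x)}"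

definition is_eigenvalue :: "real measure \<Rightarrow> real \<Rightarrow> bool" where
  "is_eigenvalue \<nu> lam \<longleftrightarrow> (\<exists>f\<in>eigenspace \<nu> lam. f \<noteq> (\<lambda>x. 0))"

definition fun_scale :: "real \<Rightarrow> (real \<Rightarrow> real) \<Rightarrow> real \<Rightarrow> real" where
  "fun_scale c f = (\<lambda>x. c * f x)"

lemma vector_space_fun_scale: "vector_space fun_scale"
  by unfold_locales (auto simp: fun_scale_def fun_eq_iff algebra_simps)

definition eigenvalue_multiplicity :: "real measure \<Rightarrow> real \<Rightarrow> nat" where
  "eigenvalue_multiplicity \<nu> lam = vector_space.dim fun_scale (eigenspace \<nu> lam)"

(* For finite \<nu> the eigenvalues are of finite multiplicity and do not accumulate at a finite
   point, so the index set is finite. *)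
definition eigenvalue_count :: "real measure \<Rightarrow> real \<Rightarrow> nat" where
  "eigenvalue_count \<nu> x =
     (\<Sum>lam | is_eigenvalue \<nu> lam \<and> lam \<le> x. eigenvalue_multiplicity \<nu> lam)"

definition lower_spectral_dim :: "real measure \<Rightarrow> ereal" where
  "lower_spectral_dim \<nu> =
     Liminf at_top (\<lambda>x. ereal (ln (real (eigenvalue_count \<nu> x)) / ln x))"

end

theory Submission
  imports Defs "HOL-Complex_Analysis.Great_Picard"
begin

text \<open>
  The form is inverted by the integral operator \<open>T\<close> with the Green kernel of the interval: on continuous
  functions vanishing outside \<open>[0,1]\<close> the eigenvalue equation becomes \<open>f = \<lambda> T f\<close>.  The operator is
  positive, self-adjoint for the inner product of \<open>L\<^sup>2(\<nu>)\<close>, and maps bounded sets to uniformly Lipschitz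
  families, so power iteration together with Arzela--Ascoli produces eigenfunctions orthogonal to any given
  finite system of eigenfunctions.  Hence \<open>N(x)\<close> is at least the dimension of any space of functions
  in \<open>H\<^sup>1\<^sub>0\<close> on which the energy is at most \<open>x\<close> times the squared \<open>L\<^sup>2(\<nu>)\<close> norm; the test functions
  need not be affine off the support, because only their images under \<open>T\<close> enter.

  Tents over dyadic intervals of level \<open>n\<close> and mass at least \<open>2\<^sup>-\<^sup>n\<^sup>s\<close> have Rayleigh quotient at most
  \<open>4 \<cdot> 2\<^sup>n\<^sup>(\<^sup>1\<^sup>+\<^sup>s\<^sup>)\<close>.  As the Minkowski dimension \<open>d\<close> exists, all levels contain \<open>2\<^sup>n\<^sup>d\<close> charged intervals up to
  subexponential factors, and for \<open>s > b\<close> only exponentially few of them are lighter than \<open>2\<^sup>-\<^sup>n\<^sup>s\<close>.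
\<close>

text \<open>On continuous functions the product of \<open>L^2(nu)\<close> is only semidefinite, and
  no completion is formed. Instead, \<open>T\<close> sees a function only through this seminorm and
  returns a continuous function: \<open>T_bound\<close> turns seminorm convergence into pointwise
  convergence, and \<open>f = lam * T f\<close> makes the seminorm a norm on every eigenspace.
  Cauchy-Schwarz bounds the square of \<open>ip f f\<close> by \<open>ip (T f) f\<close> times the
  energy of \<open>f\<close>, so an upper bound for the Rayleigh quotient of the form becomes a
  lower bound for that of \<open>T\<close>, which is what power iteration starts from. Since
  \<open>eigenvalue_count\<close> is a sum of dimensions over a set, and both notions default to 0
  in the infinite case, a lower bound for it requires finiteness; a trace estimate supplies it. On
  the counting side, the lower spectral dimension is a liminf over all \<open>x\<close>, so heavy
  intervals are needed at every large level. The limsup in \<open>Lq_spectrum\<close> is enough for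
  this because it only has to bound the number of light intervals from above.\<close>

section \<open>Square integrable weak gradients on the unit interval\<close>

text \<open>The positive and negative parts of \<open>d\<close> are densities of two finite measures
  that agree on all right rays, hence everywhere; equal measures have a.e. equal densities. This
  yields uniqueness of weak gradients.\<close>

lemma AE_zero_of_greaterThan_integrals:
  fixes d :: "real \<Rightarrow> real"
  assumes d [measurable]: "integrable lborel d"
    and zero: "\<And>x. (LINT t:{x<..}|lborel. d t) = 0"
  shows "AE x in lborel. d x = 0"
proof -
  define u where "u = (\<lambda>x. max 0 (d x))"
  define v where "v = (\<lambda>x. max 0 (- d x))"
  have u [measurable]: "integrable lborel u" and v [measurable]: "integrable lborel v"
    using d by (auto simp: u_def v_def)
  have si: "set_integrable lborel {x<..} w" if "integrable lborel w" for w :: "real \<Rightarrow> real" and x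
    using that unfolding set_integrable_def by (intro integrable_mult_indicator) auto
  have em: "emeasure (density lborel (\<lambda>x. ennreal (w x))) {x<..} = ennreal (LINT t:{x<..}|lborel. w t)"
    if w [measurable]: "integrable lborel w" and "\<And>x. 0 \<le> w x" for w :: "real \<Rightarrow> real" and x
  proof -
    have "emeasure (density lborel (\<lambda>x. ennreal (w x))) {x<..}
        = (\<integral>\<^sup>+t. ennreal (w t) * indicator {x<..} t \<partial>lborel)"
      by (subst emeasure_density) auto
    also have "\<dots> = (\<integral>\<^sup>+t. ennreal (indicator {x<..} t * w t) \<partial>lborel)"
      by (intro nn_integral_cong) (auto simp: indicator_def)
    also have "\<dots> = ennreal (LINT t|lborel. indicator {x<..} t * w t)"
    proof (rule nn_integral_eq_integral)
      show "integrable lborel (\<lambda>t. indicator {x<..} t * w t)"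
        using si[OF w] by (simp add: set_integrable_def)
      show "AE t in lborel. 0 \<le> indicator {x<..} t * w t" using that by simp
    qed
    finally show ?thesis by (simp add: set_lebesgue_integral_def)
  qed
  have "(LINT t:{x<..}|lborel. u t) = (LINT t:{x<..}|lborel. v t)" for x
  proof -
    have "(LINT t:{x<..}|lborel. u t) - (LINT t:{x<..}|lborel. v t) = (LINT t:{x<..}|lborel. u t - v t)"
      using si[OF u] si[OF v] by simp
    also have "(\<lambda>t. u t - v t) = d" by (auto simp: u_def v_def)
    finally show ?thesis using zero[of x] by simp
  qed
  moreover have "0 \<le> u x" "0 \<le> v x" for x by (auto simp: u_def v_def)
  ultimately have "density lborel (\<lambda>x. ennreal (u x)) = density lborel (\<lambda>x. ennreal (v x))"
    by (intro measure_eqI_lessThan) (simp_all add: em[OF u] em[OF v])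
  then have "AE x in lborel. ennreal (u x) = ennreal (v x)"
    by (subst (asm) sigma_finite_measure.density_unique_iff[OF lborel.sigma_finite_measure_axioms]) auto
  then show ?thesis
    by eventually_elim (auto simp: u_def v_def max_def split: if_splits)
qed

definition L2_unit :: "(real \<Rightarrow> real) \<Rightarrow> bool" where
  "L2_unit g \<longleftrightarrow> set_borel_measurable lborel {0..1} g \<and> set_integrable lborel {0..1} (\<lambda>x. (g x)\<^sup>2)"

lemma is_weak_gradient_iff:
  "is_weak_gradient f g \<longleftrightarrow> L2_unit g \<and> (\<forall>x\<in>{0..1}. f x = (LINT t:{0..x}|lborel. g t))"
  by (auto simp: is_weak_gradient_def L2_unit_def)

lemma L2_unit_mult_integrable:
  assumes "L2_unit g" "L2_unit h"
  shows "set_integrable lborel {0..1} (\<lambda>x. g x * h x)"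
proof (rule set_integrable_bound)
  show "set_integrable lborel {0..1} (\<lambda>x. (g x)\<^sup>2 + (h x)\<^sup>2)"
    using assms by (auto simp: L2_unit_def)
  have "(\<lambda>x. (indicator {0..1} x *\<^sub>R g x) * (indicator {0..1} x *\<^sub>R h x)) \<in> borel_measurable lborel"
    using assms by (intro borel_measurable_times) (auto simp: L2_unit_def set_borel_measurable_def)
  then show "set_borel_measurable lborel {0..1} (\<lambda>x. g x * h x)"
    unfolding set_borel_measurable_def
    by (rule back_subst[of "\<lambda>f. f \<in> borel_measurable lborel"]) (auto simp: indicator_def)
  have "\<bar>a * b\<bar> \<le> \<bar>a\<^sup>2 + b\<^sup>2\<bar>" for a b :: real
  proof -
    have "2 * (\<bar>a\<bar> * \<bar>b\<bar>) \<le> a\<^sup>2 + b\<^sup>2"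
      using sum_squares_bound[of "\<bar>a\<bar>" "\<bar>b\<bar>"] by simp
    moreover have "0 \<le> \<bar>a\<bar> * \<bar>b\<bar>" by simp
    ultimately show ?thesis unfolding abs_mult by linarith
  qed
  then show "AE x in lborel. x \<in> {0..1} \<longrightarrow> norm (g x * h x) \<le> norm ((g x)\<^sup>2 + (h x)\<^sup>2)"
    by auto
qed

lemma L2_unit_const: "L2_unit (\<lambda>x. c)"
  by (auto simp: L2_unit_def set_borel_measurable_def set_integrable_def)

lemma L2_unit_integrable: "L2_unit g \<Longrightarrow> set_integrable lborel {0..1} g"
  using L2_unit_mult_integrable[OF _ L2_unit_const[of 1]] by simp

lemma L2_unit_bounded:
  assumes [measurable]: "g \<in> borel_measurable borel" and "\<And>x. \<bar>g x\<bar> \<le> K"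
  shows "L2_unit g"
proof -
  have "set_integrable lborel {0..1} (\<lambda>x. (g x)\<^sup>2)"
  proof (rule set_integrable_bound[where f="\<lambda>x. K\<^sup>2"])
    show "set_integrable lborel {0..1::real} (\<lambda>x. K\<^sup>2)"
      using L2_unit_const[of K] by (simp add: L2_unit_def)
    show "AE x in lborel. x \<in> {0..1} \<longrightarrow> norm ((g x)\<^sup>2) \<le> norm (K\<^sup>2)"
      using assms(2) by (auto simp: abs_le_square_iff[symmetric] intro: order_trans[OF _ abs_ge_self])
  qed (auto simp: set_borel_measurable_def)
  then show ?thesis by (auto simp: L2_unit_def set_borel_measurable_def)
qed

lemma L2_unit_add_scale:
  assumes "L2_unit g" "L2_unit h"
  shows "L2_unit (\<lambda>x. g x + c * h x)"
proof -
  have "(\<lambda>x. indicator {0..1} x *\<^sub>R g x + c * (indicator {0..1} x *\<^sub>R h x)) \<in> borel_measurable lborel"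
    using assms by (intro borel_measurable_add borel_measurable_times) 
     (auto simp: L2_unit_def set_borel_measurable_def)
  also have "(\<lambda>x. indicator {0..1} x *\<^sub>R g x + c * (indicator {0..1} x *\<^sub>R h x))
    = (\<lambda>x. indicator {0..1} x *\<^sub>R (g x + c * h x))" by (auto simp: algebra_simps)
  finally have *: "set_borel_measurable lborel {0..1} (\<lambda>x. g x + c * h x)"
    unfolding set_borel_measurable_def .
  have "set_integrable lborel {0..1} (\<lambda>x. (g x)\<^sup>2 + 2 * c * (g x * h x) + c\<^sup>2 * (h x)\<^sup>2)"
    using assms L2_unit_mult_integrable[OF assms] by (intro set_integral_add set_integrable_mult_right) 
      (auto simp: L2_unit_def)
  also have "(\<lambda>x. (g x)\<^sup>2 + 2 * c * (g x * h x) + c\<^sup>2 * (h x)\<^sup>2) = (\<lambda>x. (g x + c * h x)\<^sup>2)"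
    by (auto simp: power2_eq_square algebra_simps)
  finally show ?thesis using * by (auto simp: L2_unit_def)
qed

text \<open>Discriminant criterion. The degenerate case \<open>c = 0\<close> matters because it
  serves for Cauchy-Schwarz in semidefinite products, where a nonzero function can have seminorm
  0.\<close>

lemma quadratic_nonneg_imp:
  fixes a b c :: real
  assumes q: "\<And>t. 0 \<le> a + 2 * t * b + t\<^sup>2 * c" and c0: "0 \<le> c"
  shows "b\<^sup>2 \<le> a * c"
proof (cases "c = 0")
  case True
  have "b = 0"
  proof (rule ccontr)
    assume "b \<noteq> 0"
    then have "2 * (- (a + 1) / (2 * b)) * b = - (a + 1)" by simp
    then show False using q[of "- (a + 1) / (2 * b)"] unfolding True by linarith
  qed
  then show ?thesis using True by simp
next
  case False
  then have c: "0 < c" using c0 by linarith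
  have "a + 2 * (- b / c) * b + (- b / c)\<^sup>2 * c = a - b\<^sup>2 / c"
    using c by (simp add: power2_eq_square field_simps)
  then have "b\<^sup>2 / c \<le> a" using q[of "- b / c"] by linarith
  then show ?thesis using c by (simp add: pos_divide_le_eq)
qed

lemma L2_unit_Cauchy_Schwarz:
  assumes "L2_unit g" "L2_unit h"
  shows "(LINT x:{0..1}|lborel. g x * h x)\<^sup>2
    \<le> (LINT x:{0..1}|lborel. (g x)\<^sup>2) * (LINT x:{0..1}|lborel. (h x)\<^sup>2)"
proof -
  let ?a = "LINT x:{0..1}|lborel. (g x)\<^sup>2" and ?b = "LINT x:{0..1}|lborel. g x * h x"
    and ?c = "LINT x:{0..1}|lborel. (h x)\<^sup>2"
  have q: "0 \<le> ?a + 2 * t * ?b + t\<^sup>2 * ?c" for t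
  proof -
    have "0 \<le> (LINT x:{0..1}|lborel. (g x + t * h x)\<^sup>2)"
      unfolding set_lebesgue_integral_def by (intro integral_nonneg_AE) auto
    also have "(\<lambda>x. (g x + t * h x)\<^sup>2) = (\<lambda>x. (g x)\<^sup>2 + (2 * t) * (g x * h x) + t\<^sup>2 * (h x)\<^sup>2)"
      by (auto simp: power2_eq_square algebra_simps)
    also have "(LINT x:{0..1}|lborel. (g x)\<^sup>2 + (2 * t) * (g x * h x) + t\<^sup>2 * (h x)\<^sup>2)
       = ?a + (2 * t) * ?b + t\<^sup>2 * ?c"
      using assms L2_unit_mult_integrable[OF assms]
      by (subst set_integral_add set_integral_mult_right; auto simp: L2_unit_def)+
    finally show ?thesis .
  qed
  show ?thesis
    by (rule quadratic_nonneg_imp[OF q])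
      (auto simp: set_lebesgue_integral_def intro!: integral_nonneg_AE)
qed

definition primitive :: "(real \<Rightarrow> real) \<Rightarrow> real \<Rightarrow> real" where
  "primitive g x = (LINT t:{0..x}|lborel. g t)"

lemma set_integrable_Icc_subset:
  fixes g :: "real \<Rightarrow> real"
  assumes "set_integrable lborel {0..1} g" "x \<le> 1"
  shows "set_integrable lborel {0..x} g"
  using assms by (intro set_integrable_subset[OF assms(1)]) auto

lemma primitive_add_scale:
  assumes "L2_unit g" "L2_unit h" "x \<le> 1"
  shows "primitive (\<lambda>t. g t + c * h t) x = primitive g x + c * primitive h x"
  using assms(1,2)[THEN L2_unit_integrable, THEN set_integrable_Icc_subset, OF assms(3)]
  by (simp add: primitive_def)

lemma is_weak_gradient_add_scale:
  assumes "is_weak_gradient f g" "is_weak_gradient f' g'"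
  shows "is_weak_gradient (\<lambda>x. f x + c * f' x) (\<lambda>x. g x + c * g' x)"
  using assms primitive_add_scale[of g g'] L2_unit_add_scale[of g g']
  by (auto simp: is_weak_gradient_iff primitive_def)

text \<open>The difference of two gradients has vanishing primitive on [0,1]. Extended by zero it
  has integral 0 over every right ray: for \<open>x\<close> in [0,1] this integral is the primitive
  at 1 minus the primitive at \<open>x\<close>.\<close>

lemma is_weak_gradient_AE_unique:
  assumes "is_weak_gradient f g" "is_weak_gradient f h"
  shows "AE x in lborel. x \<in> {0..1} \<longrightarrow> g x = h x"
proof -
  have L: "L2_unit g" "L2_unit h" using assms by (auto simp: is_weak_gradient_iff)
  define d where "d = (\<lambda>x. indicator {0..1} x *\<^sub>R (g x + (-1) * h x))"
  have L': "L2_unit (\<lambda>x. g x + (-1) * h x)" using L2_unit_add_scale[OF L] .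
  have d: "integrable lborel d"
    using L2_unit_integrable[OF L'] by (simp add: d_def set_integrable_def)
  have z: "primitive (\<lambda>x. g x + (-1) * h x) x = 0" if "x \<in> {0..1}" for x
    using that assms by (subst primitive_add_scale[OF L]) (auto simp: is_weak_gradient_iff primitive_def)
  have "(LINT t:{x<..}|lborel. d t) = 0" for x
  proof -
    let ?k = "\<lambda>x. g x + (-1) * h x"
    consider "x < 0" | "x \<in> {0..1}" | "x > 1" by fastforce
    then show ?thesis
    proof cases
      case 1
      then have "(LINT t:{x<..}|lborel. d t) = primitive ?k 1"
        unfolding set_lebesgue_integral_def d_def primitive_def
        by (intro Bochner_Integration.integral_cong) (auto simp: indicator_def)
      then show ?thesis using z[of 1] by simp
    next
      case 2
      have i: "set_integrable lborel {0..x} ?k" "set_integrable lborel {x<..1} ?k"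
        using L2_unit_integrable[OF L'] 2 by (auto elim!: set_integrable_subset)
      have "(LINT t:{x<..}|lborel. d t) = (LINT t:{x<..1}|lborel. ?k t)"
        unfolding set_lebesgue_integral_def d_def using 2
        by (intro Bochner_Integration.integral_cong) (auto simp: indicator_def)
      moreover have "primitive ?k 1 = primitive ?k x + (LINT t:{x<..1}|lborel. ?k t)"
        unfolding primitive_def using i 2
        by (subst set_integral_Un[symmetric]) (auto simp: ivl_disj_un intro!: arg_cong[of _ _ "\<lambda>A. set_lebesgue_integral lborel A _"])
      ultimately show ?thesis using z[of 1] z[of x] 2 by simp
    next
      case 3
      then have "(LINT t:{x<..}|lborel. d t) = (LINT t|(lborel :: real measure). 0)"
        unfolding set_lebesgue_integral_def d_def
        by (intro Bochner_Integration.integral_cong) (auto simp: indicator_def)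
      then show ?thesis by simp
    qed
  qed
  from AE_zero_of_greaterThan_integrals[OF d this]
  show ?thesis by eventually_elim (auto simp: d_def indicator_def)
qed

lemma is_weak_gradient_weak_gradient: "is_weak_gradient f g \<Longrightarrow> is_weak_gradient f (weak_gradient f)"
  unfolding weak_gradient_def by (rule someI[where P="is_weak_gradient f"])

lemma set_integral_Ioo_Icc_unit:
  fixes k :: "real \<Rightarrow> real"
  assumes "set_borel_measurable lborel {0..1} k"
  shows "(LINT x:{0<..<1}|lborel. k x) = (LINT x:{0..1}|lborel. k x)"
proof (rule set_integral_cong_set)
  show "set_borel_measurable lborel {0<..<1} k"
    by (rule set_borel_measurable_subset[OF assms]) auto
  have "AE x in lborel. x \<noteq> 0 \<and> x \<noteq> (1::real)"
    using AE_lborel_singleton[of 0] AE_lborel_singleton[of "1::real"] by eventually_elim auto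
  then show "AE x in lborel. (x \<in> {0..(1::real)}) = (x \<in> {0<..<1})"
    by eventually_elim auto
qed (use assms in auto)

text \<open>\<open>weak_gradient\<close> is an arbitrary choice; a.e. uniqueness lets any explicit
  gradient replace it, and the endpoints of the interval are Lebesgue null.\<close>

lemma dirichlet_form_eq:
  assumes "is_weak_gradient f u" "is_weak_gradient g v"
  shows "dirichlet_form f g = (LINT x:{0..1}|lborel. u x * v x)"
proof -
  have L: "L2_unit u" "L2_unit v" "L2_unit (weak_gradient f)" "L2_unit (weak_gradient g)"
    using assms assms[THEN is_weak_gradient_weak_gradient] by (auto simp: is_weak_gradient_iff)
  have m: "set_borel_measurable lborel {0..1} (\<lambda>x. u x * v x)"
     "set_borel_measurable lborel {0..1} (\<lambda>x. weak_gradient f x * weak_gradient g x)"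
    using L2_unit_mult_integrable[OF L(1,2)] L2_unit_mult_integrable[OF L(3,4)]
    by (auto simp: set_integrable_def set_borel_measurable_def dest: borel_measurable_integrable)
  have "AE x in lborel. x \<in> {0..1} \<longrightarrow> weak_gradient f x * weak_gradient g x = u x * v x"
    using is_weak_gradient_AE_unique[OF assms(1) is_weak_gradient_weak_gradient[OF assms(1)]]
      is_weak_gradient_AE_unique[OF assms(2) is_weak_gradient_weak_gradient[OF assms(2)]]
    by eventually_elim auto
  then show ?thesis
    unfolding dirichlet_form_def set_integral_Ioo_Icc_unit[OF m(2)]
    using m unfolding set_lebesgue_integral_def set_borel_measurable_def
    by (intro integral_cong_AE) (auto elim!: eventually_mono simp: indicator_def)
qed

section \<open>The Green operator\<close>

text \<open>Working space in place of \<open>L^2(nu)\<close>, preserved by \<open>T\<close> and by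
  uniform limits. The zero extension makes equality on [0,1] equality on the line, and continuity
  forces the value 0 at both endpoints.\<close>

definition C0_unit :: "(real \<Rightarrow> real) set" where
  "C0_unit = {f. continuous_on UNIV f \<and> (\<forall>x. x \<notin> {0..1} \<longrightarrow> f x = 0)}"

lemma C0_unit_outside: "f \<in> C0_unit \<Longrightarrow> x \<notin> {0..1} \<Longrightarrow> f x = 0"
  by (auto simp: C0_unit_def)

lemma C0_unit_measurable: "f \<in> C0_unit \<Longrightarrow> f \<in> borel_measurable borel"
  by (auto simp: C0_unit_def intro: borel_measurable_continuous_onI)

lemma C0_unit_bounded:
  assumes "f \<in> C0_unit"
  obtains K where "0 \<le> K" "\<And>x. \<bar>f x\<bar> \<le> K"
proof -
  have "compact (f ` {0..1})"
    using assms by (intro compact_continuous_image) (auto simp: C0_unit_def intro: continuous_on_subset)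
  then obtain K where K: "\<And>x. x \<in> {0..1} \<Longrightarrow> \<bar>f x\<bar> \<le> K"
    using compact_imp_bounded bounded_iff by (metis imageI real_norm_def)
  have "\<bar>f x\<bar> \<le> max 0 K" for x
    using K[of x] C0_unit_outside[OF assms, of x] by (cases "x \<in> {0..1}") auto
  then show ?thesis by (intro that[of "max 0 K"]) auto
qed

lemma C0_unit_add_scale: "f \<in> C0_unit \<Longrightarrow> g \<in> C0_unit \<Longrightarrow> (\<lambda>x. f x + c * g x) \<in> C0_unit"
  by (auto simp: C0_unit_def intro!: continuous_intros)

lemma C0_unit_zero: "(\<lambda>x. 0) \<in> C0_unit"
  by (auto simp: C0_unit_def)

lemma C0_unit_scale: "f \<in> C0_unit \<Longrightarrow> (\<lambda>x. c * f x) \<in> C0_unit"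
  using C0_unit_add_scale[OF C0_unit_zero] by simp

lemma C0_unit_sum: "(\<And>i. i \<in> I \<Longrightarrow> e i \<in> C0_unit) \<Longrightarrow> (\<lambda>x. \<Sum>i\<in>I. c i * e i x) \<in> C0_unit"
  by (auto simp: C0_unit_def intro!: continuous_intros sum.neutral)

text \<open>Green function of minus the second derivative with zero boundary values,
  \<open>min x y - x * y\<close> on the unit square. Truncation at 0 makes it vanish when one
  variable leaves [0,1] while the other stays, and keeps the Lipschitz bound.\<close>

definition green :: "real \<Rightarrow> real \<Rightarrow> real" where
  "green x y = max 0 (min (x * (1 - y)) (y * (1 - x)))"

lemma green_outside: "y \<in> {0..1} \<Longrightarrow> x \<notin> {0..1} \<Longrightarrow> green x y = 0"
  using mult_nonpos_nonneg[of x "1 - y"] mult_nonneg_nonpos[of y "1 - x"]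
  by (cases "0 \<le> x") (auto simp: green_def)

lemma green_sym: "green x y = green y x"
  by (simp add: green_def min.commute)

lemma green_outside': "x \<in> {0..1} \<Longrightarrow> y \<notin> {0..1} \<Longrightarrow> green x y = 0"
  using green_outside green_sym by metis

lemma green_eq: "x \<in> {0..1} \<Longrightarrow> y \<in> {0..1} \<Longrightarrow> green x y = min x y - x * y"
  using mult_right_le_one_le[of x y] mult_left_le_one_le[of y x]
  by (auto simp: green_def max_def min_def algebra_simps)

lemma green_abs_le:
  assumes "y \<in> {0..1}"
  shows "\<bar>green x y\<bar> \<le> 1"
proof (cases "x \<in> {0..1}")
  case True
  then have "0 \<le> x * y" using assms by simp
  moreover have "0 \<le> green x y" by (simp add: green_def)
  moreover have "min x y \<le> 1" using True by auto
  ultimately show ?thesis using green_eq[OF True assms] by linarith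
qed (simp add: green_outside[OF assms])

lemma green_lipschitz:
  assumes "y \<in> {0..1}"
  shows "\<bar>green x y - green x' y\<bar> \<le> \<bar>x - x'\<bar>"
proof -
  have 1: "\<bar>x * (1 - y) - x' * (1 - y)\<bar> \<le> \<bar>x - x'\<bar>"
    using assms by (simp add: left_diff_distrib[symmetric] abs_mult mult_right_le_one_le)
  have "y * (1 - x) - y * (1 - x') = y * (x' - x)" by (simp add: algebra_simps)
  then have 2: "\<bar>y * (1 - x) - y * (1 - x')\<bar> \<le> \<bar>x - x'\<bar>"
    using assms by (simp add: abs_mult mult_left_le_one_le abs_minus_commute)
  show ?thesis unfolding green_def using 1 2 by linarith
qed

lemma green_measurable [measurable]: "case_prod green \<in> borel_measurable (borel \<Otimes>\<^sub>M borel)"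
  unfolding green_def by measurable

lemma green_C0_unit: "x \<in> {0..1} \<Longrightarrow> green x \<in> C0_unit"
  unfolding C0_unit_def
proof (intro CollectI conjI allI impI)
  show "continuous_on UNIV (green x)" unfolding green_def[abs_def] by (intro continuous_intros)
qed (simp add: green_outside')

lemma green_abs_mult_le:
  assumes "f \<in> C0_unit"
  shows "\<bar>green x y * f y\<bar> \<le> \<bar>f y\<bar>"
  using green_abs_le[of y x] C0_unit_outside[OF assms, of y]
  by (cases "y \<in> {0..1}") (auto simp: abs_mult mult_left_le_one_le)

section \<open>The seminorm of \<open>L^2(nu)\<close> and the operator \<open>T\<close>\<close>

locale unit_measure = finite_measure \<nu> for \<nu> :: "real measure" +
  assumes on_unit: "borel_measure_on_unit \<nu>"
begin

lemma sets_nu [simp, measurable_cong]: "sets \<nu> = sets borel"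
  using on_unit by (simp add: borel_measure_on_unit_def)

lemma space_nu [simp]: "space \<nu> = UNIV"
  using sets_eq_imp_space_eq[OF sets_nu] by simp

lemma AE_unit: "AE x in \<nu>. x \<in> {0<..<1}"
  using on_unit by (intro AE_I[where N="- {0<..<1}"]) (auto simp: borel_measure_on_unit_def)

abbreviation mass :: real where "mass \<equiv> measure \<nu> UNIV"

text \<open>Only semidefinite on \<open>C0_unit\<close>: it is blind to what a function does off the
  support.\<close>

definition ip :: "(real \<Rightarrow> real) \<Rightarrow> (real \<Rightarrow> real) \<Rightarrow> real" where
  "ip f g = (LINT x|\<nu>. f x * g x)"

definition T :: "(real \<Rightarrow> real) \<Rightarrow> real \<Rightarrow> real" where
  "T f x = (LINT y|\<nu>. green x y * f y)"

text \<open>The kernel is the \<open>x\<close>-derivative of \<open>min x y - x * y\<close>; its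
  value at \<open>x = y\<close> is a convention that Lebesgue measure does not see.\<close>

definition T_grad :: "(real \<Rightarrow> real) \<Rightarrow> real \<Rightarrow> real" where
  "T_grad f x = (LINT y|\<nu>. (indicator {x<..} y - y) * f y)"

lemma measurable_nu: "f \<in> C0_unit \<Longrightarrow> f \<in> borel_measurable \<nu>"
  using C0_unit_measurable measurable_cong_sets[OF sets_nu refl] by blast

lemma integrable_nu:
  assumes "f \<in> C0_unit"
  shows "integrable \<nu> f"
proof -
  obtain K where "\<And>x. \<bar>f x\<bar> \<le> K" using C0_unit_bounded[OF assms] by metis
  then show ?thesis
    by (intro integrable_const_bound[where B=K]) (auto simp: measurable_nu assms)
qed

lemma integrable_mult_nu:
  assumes "f \<in> C0_unit" "g \<in> C0_unit"
  shows "integrable \<nu> (\<lambda>x. f x * g x)"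
proof -
  obtain K where K: "0 \<le> K" "\<And>x. \<bar>f x\<bar> \<le> K" using C0_unit_bounded[OF assms(1)] by metis
  obtain K' where K': "\<And>x. \<bar>g x\<bar> \<le> K'" using C0_unit_bounded[OF assms(2)] by metis
  have "\<bar>f x\<bar> * \<bar>g x\<bar> \<le> K * K'" for x
    using K K' by (intro mult_mono) auto
  then show ?thesis
    by (intro integrable_const_bound[where B="K*K'"])
      (auto simp: abs_mult measurable_nu assms intro!: borel_measurable_times)
qed

lemma ip_sym: "ip f g = ip g f"
  by (simp add: ip_def mult.commute)

lemma ip_add_scale:
  assumes "f \<in> C0_unit" "g \<in> C0_unit" "h \<in> C0_unit"
  shows "ip (\<lambda>x. f x + c * g x) h = ip f h + c * ip g h"
  unfolding ip_def using integrable_mult_nu[OF assms(1,3)] integrable_mult_nu[OF assms(2,3)]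
  by (simp add: ring_distribs mult.assoc)

lemma ip_add_scale_right:
  assumes "f \<in> C0_unit" "g \<in> C0_unit" "h \<in> C0_unit"
  shows "ip h (\<lambda>x. f x + c * g x) = ip h f + c * ip h g"
  using ip_add_scale[OF assms] by (simp add: ip_sym)

lemma ip_scale: "ip (\<lambda>x. c * f x) g = c * ip f g"
  by (simp add: ip_def mult.assoc)

lemma ip_scale_right: "ip g (\<lambda>x. c * f x) = c * ip g f"
  by (metis ip_scale ip_sym)

lemma ip_sum:
  assumes "\<And>i. i \<in> I \<Longrightarrow> e i \<in> C0_unit" "h \<in> C0_unit"
  shows "ip (\<lambda>x. \<Sum>i\<in>I. c i * e i x) h = (\<Sum>i\<in>I. c i * ip (e i) h)"
proof -
  have "ip (\<lambda>x. \<Sum>i\<in>I. c i * e i x) h = (LINT x|\<nu>. (\<Sum>i\<in>I. c i * (e i x * h x)))"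
    by (simp add: ip_def sum_distrib_right mult.assoc)
  also have "\<dots> = (\<Sum>i\<in>I. c i * ip (e i) h)"
    using assms integrable_mult_nu by (subst Bochner_Integration.integral_sum) (auto simp: ip_def)
  finally show ?thesis .
qed

lemma ip_nonneg: "0 \<le> ip f f"
  unfolding ip_def by (intro integral_nonneg_AE) auto

lemma ip_square_expand:
  assumes "f \<in> C0_unit" "g \<in> C0_unit"
  shows "ip (\<lambda>x. f x + c * g x) (\<lambda>x. f x + c * g x) = ip f f + 2 * c * ip f g + c\<^sup>2 * ip g g"
  using assms C0_unit_add_scale[OF assms, of c]
  by (simp add: ip_add_scale ip_add_scale_right ip_sym[of g f] power2_eq_square algebra_simps)

lemma ip_Cauchy_Schwarz:
  assumes "f \<in> C0_unit" "g \<in> C0_unit"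
  shows "(ip f g)\<^sup>2 \<le> ip f f * ip g g"
proof (rule quadratic_nonneg_imp[OF _ ip_nonneg])
  fix t show "0 \<le> ip f f + 2 * t * ip f g + t\<^sup>2 * ip g g"
    using ip_nonneg[of "\<lambda>x. f x + t * g x"] ip_square_expand[OF assms, of t] by simp
qed

lemma ip_le_sup:
  assumes "f \<in> C0_unit" "\<And>x. \<bar>f x\<bar> \<le> K"
  shows "ip f f \<le> K\<^sup>2 * mass"
proof -
  have "f x * f x \<le> K\<^sup>2" for x
    using assms(2)[of x] by (metis abs_le_square_iff abs_ge_self order_trans power2_eq_square)
  then have "ip f f \<le> (LINT x|\<nu>. K\<^sup>2)"
    unfolding ip_def using assms integrable_mult_nu by (intro integral_mono) auto
  then show ?thesis by (simp add: mult.commute)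
qed

text \<open>Cauchy-Schwarz against the constant 1, which is not in \<open>C0_unit\<close>; hence the
  quadratic is expanded directly.\<close>

lemma L1_le_L2:
  assumes f: "f \<in> C0_unit"
  shows "(LINT x|\<nu>. \<bar>f x\<bar>) \<le> sqrt (mass * ip f f)"
proof (rule real_le_rsqrt)
  have "(LINT x|\<nu>. \<bar>f x\<bar>)\<^sup>2 \<le> ip f f * mass"
  proof (rule quadratic_nonneg_imp)
    fix t
    have "0 \<le> (LINT x|\<nu>. (\<bar>f x\<bar> + t)\<^sup>2)" by (intro integral_nonneg_AE) auto
    also have "\<dots> = (LINT x|\<nu>. f x * f x + (2 * t) * \<bar>f x\<bar> + t\<^sup>2)"
      by (intro Bochner_Integration.integral_cong) (auto simp: power2_eq_square algebra_simps)
    also have "\<dots> = ip f f + (2 * t) * (LINT x|\<nu>. \<bar>f x\<bar>) + t\<^sup>2 * mass"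
      using integrable_mult_nu[OF f f] integrable_nu[OF f] by (simp add: ip_def)
    finally show "0 \<le> ip f f + 2 * t * (LINT x|\<nu>. \<bar>f x\<bar>) + t\<^sup>2 * mass" .
  qed simp
  then show "(LINT x|\<nu>. \<bar>f x\<bar>)\<^sup>2 \<le> mass * ip f f" by (simp add: mult.commute)
qed

lemma T_integrable:
  assumes "f \<in> C0_unit"
  shows "integrable \<nu> (\<lambda>y. green x y * f y)"
proof (rule Bochner_Integration.integrable_bound)
  show "integrable \<nu> f" by (rule integrable_nu[OF assms])
  show "(\<lambda>y. green x y * f y) \<in> borel_measurable \<nu>"
    using measurable_nu[OF assms] by measurable
qed (auto simp: green_abs_mult_le[OF assms])

text \<open>A supremum is controlled by the seminorm. So \<open>T\<close> annihilates functions of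
  seminorm 0 and turns seminorm convergence into pointwise convergence.\<close>

lemma T_bound:
  assumes "f \<in> C0_unit"
  shows "\<bar>T f x\<bar> \<le> sqrt (mass * ip f f)"
proof -
  have "\<bar>T f x\<bar> \<le> (LINT y|\<nu>. \<bar>green x y * f y\<bar>)" unfolding T_def by (rule integral_abs_bound)
  also have "\<dots> \<le> (LINT y|\<nu>. \<bar>f y\<bar>)"
    using T_integrable[OF assms] integrable_nu[OF assms] 
    by (intro integral_mono) (auto simp: green_abs_mult_le[OF assms])
  finally show ?thesis using L1_le_L2[OF assms] by linarith
qed

text \<open>The constant depends on \<open>f\<close> only through its seminorm, which provides the
  equicontinuity for Arzela-Ascoli.\<close>

lemma T_lipschitz:
  assumes "f \<in> C0_unit"
  shows "\<bar>T f x - T f x'\<bar> \<le> sqrt (mass * ip f f) * \<bar>x - x'\<bar>"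
proof -
  have i: "integrable \<nu> (\<lambda>y. green x y * f y - green x' y * f y)"
    using T_integrable[OF assms] by simp
  have "T f x - T f x' = (LINT y|\<nu>. green x y * f y - green x' y * f y)"
    using T_integrable[OF assms] by (simp add: T_def)
  then have "\<bar>T f x - T f x'\<bar> \<le> (LINT y|\<nu>. \<bar>green x y * f y - green x' y * f y\<bar>)"
    using integral_abs_bound by metis
  also have "\<dots> \<le> (LINT y|\<nu>. \<bar>x - x'\<bar> * \<bar>f y\<bar>)"
  proof (rule integral_mono)
    fix y
    show "\<bar>green x y * f y - green x' y * f y\<bar> \<le> \<bar>x - x'\<bar> * \<bar>f y\<bar>"
      using green_lipschitz[of y x x'] C0_unit_outside[OF assms, of y]
      by (cases "y \<in> {0..1}") (auto simp: left_diff_distrib[symmetric] abs_mult intro!: mult_right_mono)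
  qed (use i integrable_nu[OF assms] in auto)
  also have "\<dots> \<le> sqrt (mass * ip f f) * \<bar>x - x'\<bar>"
    using mult_left_mono[OF L1_le_L2[OF assms], of "\<bar>x - x'\<bar>"] by (simp add: mult.commute)
  finally show ?thesis .
qed

lemma T_C0_unit:
  assumes "f \<in> C0_unit"
  shows "T f \<in> C0_unit"
proof -
  have "(sqrt (mass * ip f f))-lipschitz_on UNIV (T f)"
    using T_lipschitz[OF assms] ip_nonneg by (intro lipschitz_onI) (auto simp: dist_real_def)
  moreover have "T f x = 0" if "x \<notin> {0..1}" for x
  proof -
    have "green x y * f y = 0" for y
      using green_outside[of y x] that C0_unit_outside[OF assms, of y] by (cases "y \<in> {0..1}") auto
    then show ?thesis unfolding T_def by (simp only: integral_zero)
  qed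
  ultimately show ?thesis using lipschitz_on_continuous_on by (auto simp: C0_unit_def)
qed

lemma T_add_scale:
  assumes "f \<in> C0_unit" "g \<in> C0_unit"
  shows "T (\<lambda>x. f x + c * g x) x = T f x + c * T g x"
  using T_integrable[OF assms(1), of x] T_integrable[OF assms(2), of x]
  by (simp add: T_def ring_distribs mult.left_commute[of _ c])

lemma T_scale: "T (\<lambda>x. c * f x) x = c * T f x"
  by (simp add: T_def mult.left_commute[of _ c])

lemma T_eq_ip: "T f x = ip (green x) f"
  by (simp add: T_def ip_def)

lemma T_grad_abs_le:
  assumes "f \<in> C0_unit"
  shows "\<bar>(indicator {x<..} y - y) * f y\<bar> \<le> \<bar>f y\<bar>"
  using C0_unit_outside[OF assms, of y]
  by (cases "y \<in> {0..1}") (auto simp: abs_mult indicator_def intro!: mult_left_le_one_le)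

lemma T_grad_measurable:
  assumes "f \<in> C0_unit"
  shows "T_grad f \<in> borel_measurable borel"
proof -
  have [measurable]: "f \<in> borel_measurable borel" by (rule C0_unit_measurable[OF assms])
  have "(\<lambda>(x, y). ((if x < y then 1 else 0) - y) * f y) \<in> borel_measurable (borel \<Otimes>\<^sub>M \<nu>)"
    by measurable
  then show ?thesis unfolding T_grad_def[abs_def]
    by (intro borel_measurable_lebesgue_integral)
      (auto simp: indicator_def greaterThan_def cong: if_cong)
qed

lemma T_grad_L2_unit:
  assumes "f \<in> C0_unit"
  shows "L2_unit (T_grad f)"
proof (rule L2_unit_bounded[OF T_grad_measurable[OF assms]])
  fix x
  have [measurable]: "f \<in> borel_measurable borel" by (rule C0_unit_measurable[OF assms])
  have i: "integrable \<nu> (\<lambda>y. (indicator {x<..} y - y) * f y)"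
    by (rule Bochner_Integration.integrable_bound[OF integrable_nu[OF assms]])
      (measurable, use T_grad_abs_le[OF assms] in auto)
  have "\<bar>T_grad f x\<bar> \<le> (LINT y|\<nu>. \<bar>(indicator {x<..} y - y) * f y\<bar>)"
    unfolding T_grad_def by (rule integral_abs_bound)
  also have "\<dots> \<le> (LINT y|\<nu>. \<bar>f y\<bar>)"
    using i integrable_nu[OF assms] T_grad_abs_le[OF assms] by (intro integral_mono) auto
  finally show "\<bar>T_grad f x\<bar> \<le> (LINT y|\<nu>. \<bar>f y\<bar>)" .
qed

text \<open>By Fubini's theorem; in distributional terms, \<open>T_grad f\<close> has derivative \<open>- f \<nu>\<close>.\<close>

lemma T_grad_integral:
  assumes f: "f \<in> C0_unit" and w: "set_integrable lborel {0..1} w"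
  shows "(LINT x:{0..1}|lborel. T_grad f x * w x) = (LINT y|\<nu>. f y * (primitive w y - y * primitive w 1))"
proof -
  interpret P: pair_sigma_finite lborel \<nu>
    by unfold_locales
  define w' where "w' = (\<lambda>x. indicator {0..1} x * w x)"
  have w' [measurable]: "integrable lborel w'" using w by (simp add: w'_def set_integrable_def)
  have [measurable]: "f \<in> borel_measurable borel" by (rule C0_unit_measurable[OF f])
  define F where "F = (\<lambda>x y. ((indicator {x<..} y - y) * f y) * w' x)"
  have Fm: "case_prod F \<in> borel_measurable (lborel \<Otimes>\<^sub>M \<nu>)"
  proof -
    have "(\<lambda>(x, y). (((if x < y then 1 else 0) - y) * f y) * w' x) \<in> borel_measurable (lborel \<Otimes>\<^sub>M \<nu>)"
      by measurable
    also have "(\<lambda>(x, y). (((if x < y then 1 else 0) - y) * f y) * w' x) = case_prod F"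
      by (auto simp: F_def indicator_def fun_eq_iff)
    finally show ?thesis .
  qed
  have bd: "\<bar>F x y\<bar> \<le> \<bar>w' x\<bar> * \<bar>f y\<bar>" for x y
    using mult_right_mono[OF T_grad_abs_le[OF f, of x y], of "\<bar>w' x\<bar>"]
    by (simp add: F_def abs_mult mult.commute)
  have Fy: "integrable \<nu> (\<lambda>y. F x y)" for x
  proof (rule Bochner_Integration.integrable_bound)
    show "integrable \<nu> (\<lambda>y. w' x * f y)" using integrable_nu[OF f] by simp
    show "(\<lambda>y. F x y) \<in> borel_measurable \<nu>" unfolding F_def by measurable
    show "AE y in \<nu>. norm (F x y) \<le> norm (w' x * f y)" using bd by (simp add: abs_mult)
  qed
  have Fi: "integrable (lborel \<Otimes>\<^sub>M \<nu>) (case_prod F)"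
  proof (rule P.Fubini_integrable[OF Fm])
    have m: "(\<lambda>x. LINT y|\<nu>. \<bar>F x y\<bar>) \<in> borel_measurable lborel"
      using Fm by (intro borel_measurable_lebesgue_integral) (simp add: split_beta')
    have "(LINT y|\<nu>. \<bar>F x y\<bar>) \<le> \<bar>w' x\<bar> * (LINT y|\<nu>. \<bar>f y\<bar>)" for x
    proof -
      have "(LINT y|\<nu>. \<bar>F x y\<bar>) \<le> (LINT y|\<nu>. \<bar>w' x\<bar> * \<bar>f y\<bar>)"
        using bd Fy integrable_nu[OF f] by (intro integral_mono) auto
      then show ?thesis by simp
    qed
    then have "AE x in lborel. norm (LINT y|\<nu>. \<bar>F x y\<bar>) \<le> norm (\<bar>w' x\<bar> * (LINT y|\<nu>. \<bar>f y\<bar>))"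
      by (intro AE_I2) (metis abs_of_nonneg abs_ge_self order_trans integral_nonneg_AE AE_I2 abs_ge_zero real_norm_def)
    then have "integrable lborel (\<lambda>x. LINT y|\<nu>. \<bar>F x y\<bar>)"
      by (intro Bochner_Integration.integrable_bound[OF _ m, of "\<lambda>x. \<bar>w' x\<bar> * (LINT y|\<nu>. \<bar>f y\<bar>)"]
        integrable_mult_left integrable_abs w')
    then show "integrable lborel (\<lambda>x. LINT y|\<nu>. norm (case (x, y) of (x, y) \<Rightarrow> F x y))"
      by simp
  qed (use Fy in auto)
  have "(LINT x:{0..1}|lborel. T_grad f x * w x) = (LINT x|lborel. LINT y|\<nu>. F x y)"
  proof -
    have "(LINT y|\<nu>. F x y) = T_grad f x * w' x" for x
      by (simp add: F_def T_grad_def)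
    then show ?thesis by (simp add: set_lebesgue_integral_def w'_def mult.left_commute)
  qed
  also have "\<dots> = (LINT y|\<nu>. LINT x|lborel. F x y)"
    using P.Fubini_integral[OF Fi] by simp
  also have "\<dots> = (LINT y|\<nu>. f y * (primitive w y - y * primitive w 1))"
  proof (rule Bochner_Integration.integral_cong[OF refl])
    fix y
    show "(LINT x|lborel. F x y) = f y * (primitive w y - y * primitive w 1)"
    proof (cases "y \<in> {0..1}")
      case True
      \<comment> \<open>As a function of \<open>x\<close> the indicator is that of
        \<open>{..<y}\<close>, while \<open>primitive\<close> integrates over a closed interval; the
        two differ at one point.\<close>
      have "AE x in lborel. x \<noteq> y" by (rule AE_lborel_singleton)
      then have "AE x in lborel. F x y = f y * (indicator {..y} x * w' x - y * w' x)"
        by eventually_elim (auto simp: F_def indicator_def algebra_simps)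
      then have "(LINT x|lborel. F x y) = (LINT x|lborel. f y * (indicator {..y} x * w' x - y * w' x))"
      proof (intro integral_cong_AE)
        have "(\<lambda>x. F x y) = (\<lambda>x. ((indicator {..<y} x - y) * f y) * w' x)"
          by (auto simp: F_def indicator_def)
        also have "\<dots> \<in> borel_measurable lborel" by measurable
        finally show "(\<lambda>x. F x y) \<in> borel_measurable lborel" .
        show "(\<lambda>x. f y * (indicator {..y} x * w' x - y * w' x)) \<in> borel_measurable lborel"
          by measurable
      qed
      also have "\<dots> = (LINT x|lborel. f y * (indicator {0..y} x * w x - y * (indicator {0..1} x * w x)))"
        using True by (intro Bochner_Integration.integral_cong) (auto simp: w'_def indicator_def)
      also have "\<dots> = f y * (primitive w y - y * primitive w 1)"
      proof -
        have "set_integrable lborel {0..y} w" using True w by (intro set_integrable_subset[OF w]) auto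
        then show ?thesis using w by (simp add: primitive_def set_lebesgue_integral_def set_integrable_def)
      qed
      finally show ?thesis .
    qed (simp add: F_def C0_unit_outside[OF f])
  qed
  finally show ?thesis .
qed

text \<open>Take for \<open>w\<close> in the Fubini identity the indicator of \<open>{..x}\<close>:
  its primitive is \<open>min x y\<close>, and \<open>min x y - y * x\<close> is the Green
  function.\<close>

lemma T_eq_primitive:
  assumes f: "f \<in> C0_unit" and x: "x \<in> {0..1}"
  shows "T f x = primitive (T_grad f) x"
proof -
  let ?w = "indicator {..x} :: real \<Rightarrow> real"
  have w: "set_integrable lborel {0..1} ?w"
    by (intro L2_unit_integrable L2_unit_bounded[where K=1]) (auto simp: indicator_def)
  have pw: "primitive ?w y = min x y" if "y \<in> {0..1}" for y
  proof -
    have "primitive ?w y = (LINT t|lborel. indicator {0..min x y} t)"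
      unfolding primitive_def set_lebesgue_integral_def
      by (intro Bochner_Integration.integral_cong) (auto simp: indicator_def)
    then show ?thesis using that x by simp
  qed
  have "primitive (T_grad f) x = (LINT t:{0..1}|lborel. T_grad f t * ?w t)"
    unfolding primitive_def set_lebesgue_integral_def using x
    by (intro Bochner_Integration.integral_cong) (auto simp: indicator_def)
  also have "\<dots> = (LINT y|\<nu>. f y * (primitive ?w y - y * primitive ?w 1))"
    by (rule T_grad_integral[OF f w])
  also have "\<dots> = T f x"
    unfolding T_def
  proof (rule Bochner_Integration.integral_cong[OF refl])
    fix y
    show "f y * (primitive ?w y - y * primitive ?w 1) = green x y * f y"
      using pw[of y] pw[of 1] x green_eq[OF x, of y] C0_unit_outside[OF f, of y]
      by (cases "y \<in> {0..1}") (auto simp: min_def mult.commute)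
  qed
  finally show ?thesis by simp
qed

lemma T_weak_gradient: "f \<in> C0_unit \<Longrightarrow> is_weak_gradient (T f) (T_grad f)"
  by (simp add: is_weak_gradient_iff T_grad_L2_unit T_eq_primitive primitive_def)

text \<open>Weak form of the statement that minus the second derivative of \<open>T f\<close> is the
  measure \<open>f nu\<close>. The boundary term carries the factor
  \<open>primitive w 1 = g 1\<close>, which is 0.\<close>

lemma T_grad_pairing:
  assumes f: "f \<in> C0_unit" and g: "is_weak_gradient g w" "g 1 = 0"
  shows "(LINT x:{0..1}|lborel. T_grad f x * w x) = ip f g"
proof -
  have w: "set_integrable lborel {0..1} w" using g by (auto simp: is_weak_gradient_iff L2_unit_integrable)
  have "f y * (primitive w y - y * primitive w 1) = f y * g y" for y
    using g C0_unit_outside[OF f, of y] by (cases "y \<in> {0..1}") (auto simp: is_weak_gradient_iff primitive_def)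
  then show ?thesis using T_grad_integral[OF f w] by (simp only: ip_def)
qed

lemma T_at_endpoints: "T f 1 = 0" "T f 0 = 0"
proof -
  have "AE y in \<nu>. green 1 y * f y = 0" "AE y in \<nu>. green 0 y * f y = 0"
    using AE_unit by (auto simp: green_def elim!: eventually_mono)
  then show "T f 1 = 0" "T f 0 = 0" unfolding T_def by (auto intro: integral_eq_zero_AE)
qed

text \<open>The right side is the form between the two Green potentials, symmetric and nonnegative
  on the diagonal: self-adjointness and positivity of \<open>T\<close> come from here.\<close>

lemma ip_T_eq: "f \<in> C0_unit \<Longrightarrow> g \<in> C0_unit \<Longrightarrow> ip f (T g) = (LINT x:{0..1}|lborel. T_grad f x * T_grad g x)"
  using T_grad_pairing[OF _ T_weak_gradient T_at_endpoints(1)] by simp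

lemma T_selfadjoint: "f \<in> C0_unit \<Longrightarrow> g \<in> C0_unit \<Longrightarrow> ip (T f) g = ip f (T g)"
  using ip_T_eq[of f g] ip_T_eq[of g f] by (simp add: ip_sym mult.commute)

lemma T_nonneg: "f \<in> C0_unit \<Longrightarrow> 0 \<le> ip (T f) f"
  using ip_T_eq[of f f] by (auto simp: ip_sym[of "T f"] set_lebesgue_integral_def intro!: integral_nonneg_AE)

text \<open>\<open>ip f f\<close> is the form between \<open>T f\<close> and \<open>f\<close>, and
  the energy of \<open>T f\<close> is \<open>ip (T f) f\<close>; apply Cauchy-Schwarz. For
  \<open>x > 0\<close>, energy at most \<open>x * ip f f\<close> thus forces
  \<open>ip f f <= x * ip (T f) f\<close>.\<close>

lemma ip_square_le_energy:
  assumes f: "f \<in> C0_unit" and w: "is_weak_gradient f w" "f 1 = 0"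
  shows "(ip f f)\<^sup>2 \<le> ip (T f) f * (LINT x:{0..1}|lborel. (w x)\<^sup>2)"
proof -
  have "(ip f f)\<^sup>2 = (LINT x:{0..1}|lborel. T_grad f x * w x)\<^sup>2"
    using T_grad_pairing[OF f w] by simp
  also have "\<dots> \<le> (LINT x:{0..1}|lborel. (T_grad f x)\<^sup>2) * (LINT x:{0..1}|lborel. (w x)\<^sup>2)"
    using w T_grad_L2_unit[OF f] by (intro L2_unit_Cauchy_Schwarz) (auto simp: is_weak_gradient_iff)
  also have "(LINT x:{0..1}|lborel. (T_grad f x)\<^sup>2) = ip (T f) f"
    using ip_T_eq[OF f f] by (simp add: ip_sym power2_eq_square)
  finally show ?thesis .
qed

end

section \<open>Eigenfunctions\<close>

text \<open>Gaussian elimination: fewer linear equations, indexed by \<open>S\<close>, than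
  unknowns, indexed by \<open>I\<close>.\<close>

lemma exists_nontrivial_kernel:
  fixes A :: "'i \<Rightarrow> 'e \<Rightarrow> real"
  assumes "finite I" "finite S" "card S < card I"
  shows "\<exists>c. (\<exists>i\<in>I. c i \<noteq> 0) \<and> (\<forall>e\<in>S. (\<Sum>i\<in>I. c i * A i e) = 0)"
  using assms(2,1,3)
proof (induction S arbitrary: I A rule: finite_induct)
  case empty
  then obtain i where "i \<in> I" by (metis card.empty ex_in_conv less_irrefl)
  then show ?case by (intro exI[of _ "\<lambda>_. 1"]) auto
next
  case (insert s S)
  have less: "card S < card I" using insert by simp
  show ?case
  proof (cases "\<forall>i\<in>I. A i s = 0")
    case True
    obtain c where "\<exists>i\<in>I. c i \<noteq> 0" "\<forall>e\<in>S. (\<Sum>i\<in>I. c i * A i e) = 0"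
      using insert.IH[OF insert.prems(1) less, of A] by blast
    then show ?thesis using True by (intro exI[of _ c]) auto
  next
    case False
    then obtain j where j: "j \<in> I" "A j s \<noteq> 0" by auto
    \<comment> \<open>Equation \<open>s\<close> eliminates unknown \<open>j\<close> from the others;
      afterwards the value \<open>- q\<close> for this unknown satisfies equation
      \<open>s\<close>.\<close>
    define A' where "A' = (\<lambda>i e. A i e - A i s / A j s * A j e)"
    have "finite (I - {j})" "card S < card (I - {j})"
      using insert j by auto
    then obtain c where c: "\<exists>i\<in>I-{j}. c i \<noteq> 0" "\<forall>e\<in>S. (\<Sum>i\<in>I-{j}. c i * A' i e) = 0"
      using insert.IH[of "I - {j}" A'] by blast
    define q where "q = (\<Sum>i\<in>I-{j}. c i * A i s) / A j s"
    define c' where "c' = (\<lambda>i. if i = j then - q else c i)"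
    have s: "(\<Sum>i\<in>I. c' i * A i e) = (\<Sum>i\<in>I-{j}. c i * A i e) - q * A j e" for e
      using j insert.prems(1) by (simp add: sum.remove[of I j] c'_def)
    have "(\<Sum>i\<in>I. c' i * A i e) = (\<Sum>i\<in>I-{j}. c i * A' i e)" for e
      unfolding s q_def A'_def
      by (simp add: algebra_simps sum_subtractf sum_divide_distrib sum_distrib_left sum_distrib_right)
    moreover have "(\<Sum>i\<in>I. c' i * A i s) = 0" unfolding s q_def using j by simp
    moreover have "\<exists>i\<in>I. c' i \<noteq> 0" using c(1) by (auto simp: c'_def)
    ultimately show ?thesis using c(2) by (intro exI[of _ c']) auto
  qed
qed

lemma is_weak_gradient_zero: "is_weak_gradient (\<lambda>x. 0) (\<lambda>x. 0)"
  by (simp add: is_weak_gradient_iff L2_unit_const)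

lemma dom_form_C0_unit:
  assumes "f \<in> dom_form \<nu>"
  shows "f \<in> C0_unit"
proof -
  have f: "continuous_on {0..1} f" "\<And>x. x \<notin> {0..1} \<Longrightarrow> f x = 0" "f 0 = 0" "f 1 = 0"
    using assms by (auto simp: dom_form_def C_affine_off_support_def H10_def)
  have "continuous_on {..0} f"
    by (rule continuous_on_eq[of _ "\<lambda>x. 0"]) (use f in \<open>auto simp: less_le\<close>, metis f(2,3) atLeastAtMost_iff order_antisym)
  moreover have "continuous_on {1..} f"
    by (rule continuous_on_eq[of _ "\<lambda>x. 0"]) (auto, metis f(2,4) atLeastAtMost_iff order_antisym)
  ultimately have "continuous_on ({..0} \<union> {0..1} \<union> {1..}) f"
    using f(1) by (intro continuous_on_closed_Un) auto
  moreover have "{..0} \<union> {0..1} \<union> {1..} = (UNIV :: real set)" by auto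
  ultimately show ?thesis using f by (simp add: C0_unit_def)
qed

lemma dom_form_weak_gradient: "f \<in> dom_form \<nu> \<Longrightarrow> is_weak_gradient f (weak_gradient f)"
  by (auto simp: dom_form_def H10_def intro: is_weak_gradient_weak_gradient)

lemma dom_form_endpoint: "f \<in> dom_form \<nu> \<Longrightarrow> f 1 = 0"
  by (auto simp: dom_form_def H10_def)

lemma dom_form_add_scale:
  assumes "f \<in> dom_form \<nu>" "g \<in> dom_form \<nu>"
  shows "(\<lambda>x. f x + c * g x) \<in> dom_form \<nu>"
proof -
  have "\<exists>m d. \<forall>x\<in>I. f x + c * g x = m * x + d"
    if "I \<in> components ({0..1} - measure_support \<nu>)" for I
  proof -
    have "\<exists>m d. \<forall>x\<in>I. f x = m * x + d" "\<exists>m d. \<forall>x\<in>I. g x = m * x + d"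
      using assms that by (simp_all add: dom_form_def C_affine_off_support_def)
    then obtain m d m' d' where "\<And>x. x \<in> I \<Longrightarrow> f x = m * x + d" "\<And>x. x \<in> I \<Longrightarrow> g x = m' * x + d'"
      by metis
    then show ?thesis by (intro exI[of _ "m + c * m'"] exI[of _ "d + c * d'"]) (auto simp: algebra_simps)
  qed
  moreover have "\<exists>w. is_weak_gradient (\<lambda>x. f x + c * g x) w"
    using is_weak_gradient_add_scale[OF assms[THEN dom_form_weak_gradient]] by blast
  ultimately show ?thesis
    using assms by (auto simp: dom_form_def C_affine_off_support_def H10_def intro!: continuous_intros)
qed

text \<open>Each point off the support lies in a null basic open set, and there are only countably
  many basic sets.\<close>

lemma AE_measure_support:
  fixes \<nu> :: "'a::second_countable_topology measure"
  assumes "sets \<nu> = sets borel"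
  shows "AE x in \<nu>. x \<in> measure_support \<nu>"
proof -
  obtain B :: "'a set set" where B: "countable B" "topological_basis B"
    using ex_countable_basis by blast
  let ?N = "{b \<in> B. emeasure \<nu> b = 0}"
  have op: "open b" if "b \<in> B" for b using B that by (simp add: topological_basis_open)
  have null: "(\<Union>b\<in>?N. b) \<in> null_sets \<nu>"
    using B(1) op by (intro null_sets_UN') (auto simp: null_sets_def assms borel_open)
  have "{x \<in> space \<nu>. x \<notin> measure_support \<nu>} \<subseteq> (\<Union>b\<in>?N. b)"
  proof
    fix x assume "x \<in> {x \<in> space \<nu>. x \<notin> measure_support \<nu>}"
    then obtain U where U: "open U" "x \<in> U" "emeasure \<nu> U = 0"
      by (auto simp: measure_support_def zero_less_iff_neq_zero)
    obtain b where b: "b \<in> B" "x \<in> b" "b \<subseteq> U"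
      using topological_basisE[OF B(2) U(1,2)] by metis
    have "emeasure \<nu> b \<le> emeasure \<nu> U"
      using b U by (intro emeasure_mono) (auto simp: assms)
    then show "x \<in> (\<Union>b\<in>?N. b)" using b U by auto
  qed
  then show ?thesis using null by (rule AE_I'[rotated])
qed

context unit_measure
begin

text \<open>A component carries no mass, so moving \<open>x\<close> inside it changes the ray
  \<open>{x<..}\<close> by a null set only. With the ray frozen at \<open>x0\<close> the kernel is
  affine in \<open>x\<close>.\<close>

lemma T_affine_off_support:
  assumes f: "f \<in> C0_unit" and I: "I \<in> components ({0..1} - measure_support \<nu>)"
  shows "\<exists>m d. \<forall>x\<in>I. T f x = m * x + d"
proof -
  have conn: "connected I" and sub: "I \<subseteq> {0..1} - measure_support \<nu>"
    using in_components_connected[OF I] in_components_subset[OF I] by auto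
  obtain x0 where x0: "x0 \<in> I" using in_components_nonempty[OF I] by auto
  have ae: "AE y in \<nu>. y \<in> {0<..<1} \<and> y \<notin> I"
    using AE_unit AE_measure_support[OF sets_nu] by eventually_elim (use sub in auto)
  let ?d = "LINT y|\<nu>. indicator {..x0} y * (y * f y)"
  have [measurable]: "f \<in> borel_measurable borel" by (rule C0_unit_measurable[OF f])
  have i1: "integrable \<nu> (\<lambda>y. (indicator {x0<..} y - y) * f y)"
    by (rule Bochner_Integration.integrable_bound[OF integrable_nu[OF f]])
      (measurable, use T_grad_abs_le[OF f] in auto)
  have b: "\<bar>indicator {..x0} y * (y * f y)\<bar> \<le> \<bar>f y\<bar>" for y
    using C0_unit_outside[OF f, of y]
    by (cases "y \<in> {0..1}") (auto simp: abs_mult indicator_def intro!: mult_left_le_one_le)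
  have i2: "integrable \<nu> (\<lambda>y. indicator {..x0} y * (y * f y))"
    by (rule Bochner_Integration.integrable_bound[OF integrable_nu[OF f]])
      (measurable, use b in auto)
  have "T f x = T_grad f x0 * x + ?d" if x: "x \<in> I" for x
  proof -
    have "AE y in \<nu>. green x y * f y
      = x * ((indicator {x0<..} y - y) * f y) + indicator {..x0} y * (y * f y)"
      using ae
    proof eventually_elim
      case (elim y)
      \<comment> \<open>\<open>I\<close> contains the segment between \<open>x\<close> and
        \<open>x0\<close>, so both points lie on the same side of \<open>y\<close>.\<close>
      have "y \<notin> {min x x0..max x x0}"
        using connected_contains_Icc[OF conn x x0] connected_contains_Icc[OF conn x0 x] elim
        by (auto simp: min_def max_def split: if_splits)
      moreover have "x \<in> {0..1}" using x sub by auto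
      ultimately have "green x y = x * (indicator {x0<..} y - y) + indicator {..x0} y * y"
        using elim green_eq[of x y]
        by (auto simp: indicator_def min_def max_def algebra_simps split: if_splits)
      then show ?case by (simp add: distrib_right mult.assoc)
    qed
    then have "T f x = (LINT y|\<nu>. x * ((indicator {x0<..} y - y) * f y) + indicator {..x0} y * (y * f y))"
      unfolding T_def by (intro integral_cong_AE) measurable
    also have "\<dots> = T_grad f x0 * x + ?d"
      using i1 i2 by (simp add: T_grad_def)
    finally show ?thesis .
  qed
  then show ?thesis by blast
qed

lemma T_dom_form: 
  assumes "f \<in> C0_unit"
  shows "T f \<in> dom_form \<nu>"
  using T_C0_unit[OF assms] T_weak_gradient[OF assms] T_affine_off_support[OF assms] T_at_endpoints[of f]
  by (auto simp: dom_form_def H10_def C_affine_off_support_def C0_unit_def intro: continuous_on_subset)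

lemma dom_form_zero: "(\<lambda>x. 0) \<in> dom_form \<nu>"
  using dom_form_add_scale[OF T_dom_form T_dom_form, OF C0_unit_zero C0_unit_zero, of "-1"] by simp

text \<open>Insert \<open>g = f - lam * T f\<close> into the eigenvalue equation for
  \<open>f\<close> and into the weak form for \<open>T f\<close>: the energy of \<open>g\<close> is
  0. That \<open>T f\<close> is affine off the support is what admits \<open>g\<close> as a test
  function.\<close>

lemma eigenspace_imp_fixed:
  assumes "f \<in> eigenspace \<nu> lam"
  shows "f x = lam * T f x"
proof -
  have fd: "f \<in> dom_form \<nu>" using assms by (simp add: eigenspace_def)
  then have f: "f \<in> C0_unit" by (rule dom_form_C0_unit)
  define g where "g = (\<lambda>x. f x + (- lam) * T f x)"
  define v where "v = (\<lambda>x. weak_gradient f x + (- lam) * T_grad f x)"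
  have gd: "g \<in> dom_form \<nu>" unfolding g_def by (intro dom_form_add_scale fd T_dom_form f)
  have v: "is_weak_gradient g v" unfolding g_def v_def
    by (intro is_weak_gradient_add_scale dom_form_weak_gradient[OF fd] T_weak_gradient f)
  have L: "L2_unit v" "L2_unit (weak_gradient f)" "L2_unit (T_grad f)"
    using v dom_form_weak_gradient[OF fd] T_grad_L2_unit[OF f] by (auto simp: is_weak_gradient_iff)
  have 1: "(LINT x:{0..1}|lborel. weak_gradient f x * v x) = lam * ip f g"
    using assms gd dirichlet_form_eq[OF dom_form_weak_gradient[OF fd] v]
    by (auto simp: eigenspace_def ip_def)
  have 2: "(LINT x:{0..1}|lborel. T_grad f x * v x) = ip f g"
    by (rule T_grad_pairing[OF f v dom_form_endpoint[OF gd]])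
  have "(LINT x:{0..1}|lborel. (v x)\<^sup>2) = (LINT x:{0..1}|lborel. weak_gradient f x * v x + (- lam) * (T_grad f x * v x))"
    by (auto simp: v_def power2_eq_square algebra_simps)
  also have "\<dots> = 0"
    using L2_unit_mult_integrable[OF L(2,1)] L2_unit_mult_integrable[OF L(3,1)] 1 2
    by (simp add: set_integral_add(2) del: mult_minus_left)
  finally have z: "(LINT x:{0..1}|lborel. (v x)\<^sup>2) = 0" .
  have "g x = 0"
  proof (cases "x \<in> {0..1}")
    case True
    \<comment> \<open>Cauchy-Schwarz with this indicator bounds the square of the value
      \<open>g x\<close> by a multiple of the energy.\<close>
    let ?w = "indicator {..x} :: real \<Rightarrow> real"
    have "L2_unit ?w" by (rule L2_unit_bounded[where K=1]) (auto simp: indicator_def)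
    then have "(LINT t:{0..1}|lborel. v t * ?w t)\<^sup>2 \<le> 0"
      using L2_unit_Cauchy_Schwarz[OF L(1)] z by fastforce
    moreover have "g x = (LINT t:{0..1}|lborel. v t * ?w t)"
      using v True unfolding is_weak_gradient_iff set_lebesgue_integral_def
      by (auto simp: indicator_def intro!: Bochner_Integration.integral_cong)
    ultimately show ?thesis by simp
  next
    case False
    then show ?thesis using C0_unit_outside[OF dom_form_C0_unit[OF gd]] by simp
  qed
  then show ?thesis by (simp add: g_def)
qed

lemma fixed_imp_eigenspace:
  assumes f: "f \<in> C0_unit" and fixed: "\<And>x. f x = lam * T f x"
  shows "f \<in> eigenspace \<nu> lam"
proof -
  have eq: "f = (\<lambda>x. 0 + lam * T f x)" using fixed by auto
  have fd: "f \<in> dom_form \<nu>"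
    by (subst eq) (intro dom_form_add_scale dom_form_zero T_dom_form f)
  have w: "is_weak_gradient f (\<lambda>x. 0 + lam * T_grad f x)"
    by (subst eq) (intro is_weak_gradient_add_scale is_weak_gradient_zero T_weak_gradient f)
  have "dirichlet_form f g = lam * (LINT x|\<nu>. f x * g x)" if g: "g \<in> dom_form \<nu>" for g
    using dirichlet_form_eq[OF w dom_form_weak_gradient[OF g]]
      T_grad_pairing[OF f dom_form_weak_gradient[OF g] dom_form_endpoint[OF g]]
    by (simp add: ip_def mult.assoc)
  then show ?thesis using fd by (simp add: eigenspace_def)
qed

text \<open>From here on eigenspaces are handled through \<open>T\<close> alone, without gradients
  or the affine condition.\<close>

lemma eigenspace_eq: "eigenspace \<nu> lam = {f \<in> C0_unit. \<forall>x. f x = lam * T f x}"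
proof (intro set_eqI iffI)
  fix f assume f: "f \<in> eigenspace \<nu> lam"
  then have "f \<in> dom_form \<nu>" by (simp add: eigenspace_def)
  with f show "f \<in> {f \<in> C0_unit. \<forall>x. f x = lam * T f x}"
    by (blast intro: dom_form_C0_unit eigenspace_imp_fixed)
qed (blast intro: fixed_imp_eigenspace)

lemma eigenspace_add_scale:
  "f \<in> eigenspace \<nu> lam \<Longrightarrow> g \<in> eigenspace \<nu> lam \<Longrightarrow> (\<lambda>x. f x + c * g x) \<in> eigenspace \<nu> lam"
  unfolding eigenspace_eq
proof (intro CollectI conjI allI; elim CollectE conjE)
  fix x assume fg: "f \<in> C0_unit" "\<forall>x. f x = lam * T f x" "g \<in> C0_unit" "\<forall>x. g x = lam * T g x"
  have "f x + c * g x = lam * T f x + c * (lam * T g x)" using fg by metis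
  also have "\<dots> = lam * T (\<lambda>x. f x + c * g x) x"
    using fg(1,3) by (simp add: T_add_scale algebra_simps)
  finally show "f x + c * g x = lam * T (\<lambda>x. f x + c * g x) x" .
qed (rule C0_unit_add_scale)

lemma eigenspace_zero: "(\<lambda>x. 0) \<in> eigenspace \<nu> lam"
  by (intro fixed_imp_eigenspace C0_unit_zero) (simp add: T_def)

lemma eigenspace_scale: "g \<in> eigenspace \<nu> lam \<Longrightarrow> (\<lambda>x. c * g x) \<in> eigenspace \<nu> lam"
  using eigenspace_add_scale[OF eigenspace_zero] by simp

lemma eigenspace_sum:
  "(\<And>i. i \<in> I \<Longrightarrow> e i \<in> eigenspace \<nu> lam) \<Longrightarrow> (\<lambda>x. \<Sum>i\<in>I. c i * e i x) \<in> eigenspace \<nu> lam"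
proof (induction I rule: infinite_finite_induct)
  case (insert i I)
  then have "(\<lambda>x. (\<Sum>i\<in>I. c i * e i x) + c i * e i x) \<in> eigenspace \<nu> lam"
    by (intro eigenspace_add_scale) auto
  then show ?case using insert by (simp add: add.commute)
qed (auto simp: eigenspace_zero)

lemma eigenspace_C0_unit: "f \<in> eigenspace \<nu> lam \<Longrightarrow> f \<in> C0_unit"
  by (simp add: eigenspace_eq)

lemma ip_eigenspace:
  assumes "f \<in> eigenspace \<nu> lam"
  shows "ip f g = lam * ip (T f) g"
proof -
  have "f = (\<lambda>x. lam * T f x)" using eigenspace_imp_fixed[OF assms] by auto
  then show ?thesis by (metis ip_scale)
qed

text \<open>If \<open>f\<close> had seminorm 0, then \<open>T f\<close> and with it
  \<open>lam * T f = f\<close> would vanish. The sign of \<open>lam\<close> comes from positivity of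
  \<open>T\<close>.\<close>

lemma eigenspace_nonzero:
  assumes f: "f \<in> eigenspace \<nu> lam" and nz: "f \<noteq> (\<lambda>x. 0)"
  shows "0 < ip f f" "0 < lam"
proof -
  have "ip f f \<noteq> 0"
  proof
    assume "ip f f = 0"
    then have "T f x = 0" for x using T_bound[OF eigenspace_C0_unit[OF f], of x] by simp
    then show False using nz eigenspace_imp_fixed[OF f] by fastforce
  qed
  then show "0 < ip f f" using ip_nonneg[of f] by linarith
  then have "0 < lam * ip (T f) f" using ip_eigenspace[OF f, of f] by simp
  then show "0 < lam"
    using T_nonneg[OF eigenspace_C0_unit[OF f]] by (simp add: zero_less_mult_iff)
qed

lemma eigenspace_orthogonal:
  assumes f: "f \<in> eigenspace \<nu> lam" and g: "g \<in> eigenspace \<nu> mu" and ne: "lam \<noteq> mu"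
  shows "ip f g = 0"
proof -
  have "ip f g = lam * ip (T f) g" by (rule ip_eigenspace[OF f])
  moreover have "ip f g = mu * ip (T f) g"
    using ip_eigenspace[OF g, of f] T_selfadjoint[OF eigenspace_C0_unit[OF f] eigenspace_C0_unit[OF g]]
    by (simp add: ip_sym)
  ultimately show ?thesis using ne by auto
qed

section \<open>Existence of eigenfunctions\<close>

text \<open>Cauchy-Schwarz for the energy of the Green potentials; it serves the odd moments of the
  power iteration.\<close>

lemma T_Cauchy_Schwarz:
  assumes "f \<in> C0_unit" "g \<in> C0_unit"
  shows "(ip (T f) g)\<^sup>2 \<le> ip (T f) f * ip (T g) g"
  using L2_unit_Cauchy_Schwarz[OF assms[THEN T_grad_L2_unit]] assms
  unfolding T_selfadjoint[OF assms] T_selfadjoint[OF assms(1,1)] T_selfadjoint[OF assms(2,2)]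
    ip_T_eq[OF assms] ip_T_eq[OF assms(1,1)] ip_T_eq[OF assms(2,2)]
  by (simp only: power2_eq_square)

text \<open>Power iteration: the quotients of consecutive moments \<open>ip (T\<^sup>n f) f\<close> increase, and the
  normalised iterates are approximate eigenfunctions for their limit.\<close>

lemma exists_eigenfunction:
  assumes f: "f \<in> C0_unit" and pos: "0 < ip f f" "0 < s" and s: "s * ip f f \<le> ip (T f) f"
  obtains g mu where "g \<in> C0_unit" "s \<le> mu" "\<And>x. T g x = mu * g x" "0 < ip g g"
    "\<And>e lam. e \<in> eigenspace \<nu> lam \<Longrightarrow> ip f e = 0 \<Longrightarrow> ip g e = 0"
proof -
  define F where "F = (\<lambda>n. (T ^^ n) f)"
  have F0: "F 0 = f" and FS: "F (Suc n) = T (F n)" for n by (auto simp: F_def)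
  have F [simp]: "F n \<in> C0_unit" for n by (induction n) (auto simp: F0 FS f T_C0_unit)
  define a where "a = (\<lambda>n. ip (F n) f)"
  \<comment> \<open>Self-adjointness shifts powers of \<open>T\<close> from one argument to the
    other, so every such product is a moment.\<close>
  have a: "ip (F i) (F j) = a (i + j)" for i j
  proof (induction j arbitrary: i)
    case (Suc j)
    have "ip (F i) (F (Suc j)) = ip (F (Suc i)) (F j)" by (simp add: FS T_selfadjoint)
    then show ?case using Suc[of "Suc i"] by simp
  qed (simp add: a_def F0)
  have logconv: "(a (Suc n))\<^sup>2 \<le> a n * a (Suc (Suc n))" for n
  proof (cases "even n")
    case True
    then obtain k where n: "n = k + k" by (metis evenE mult_2)
    then show ?thesis using ip_Cauchy_Schwarz[of "F k" "F (Suc k)"] by (simp add: a)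
  next
    case False
    then obtain k where n: "n = Suc (k + k)" by (metis oddE mult_2 Suc_eq_plus1)
    then show ?thesis using T_Cauchy_Schwarz[of "F k" "F (Suc k)"] by (simp add: a FS[symmetric])
  qed
  have "0 < a n \<and> 0 < a (Suc n)" for n
  proof (induction n)
    case 0
    have "0 < ip (T f) f" using mult_pos_pos[OF pos(2,1)] s by linarith
    then show ?case using pos by (simp add: a_def F0 FS)
  next
    case (Suc n)
    then have "0 < a n * a (Suc (Suc n))" using logconv[of n] by (smt (verit) zero_less_power)
    then show ?case using Suc by (simp add: zero_less_mult_iff)
  qed
  then have apos [simp]: "0 < a n" for n by blast
  then have anz [simp]: "a n \<noteq> 0" for n by (metis less_irrefl)
  define r where "r = (\<lambda>n. a (Suc n) / a n)"
  have "r n \<le> r (Suc n)" for n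
    using logconv[of n] by (simp add: r_def field_simps power2_eq_square)
  then have inc: "incseq r" by (rule incseq_SucI)
  have rpos: "0 < r n" for n by (simp add: r_def)
  have rr: "r n * r (Suc n) = a (Suc (Suc n)) / a n" for n by (simp add: r_def)
  have Tb: "ip (T u) (T u) \<le> mass\<^sup>2 * ip u u" if "u \<in> C0_unit" for u
    using ip_le_sup[OF T_C0_unit[OF that] T_bound[OF that]] ip_nonneg[of u]
    by (simp add: power2_eq_square mult.commute mult.left_commute)
  have rb: "r n \<le> mass" for n
  proof -
    \<comment> \<open>Doubling the index reaches even moments, where
      \<open>r (n + n) * r (Suc (n + n))\<close> is the quotient of the squared seminorms of
      \<open>T (F n)\<close> and \<open>F n\<close>, at most the square of
      \<open>mass\<close>.\<close>
    have "r n \<le> r (n + n)" using inc by (simp add: incseq_def)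
    moreover have "(r (n + n))\<^sup>2 \<le> mass\<^sup>2"
    proof -
      have "(r (n + n))\<^sup>2 \<le> r (n + n) * r (Suc (n + n))"
        unfolding power2_eq_square using inc rpos[of "n + n"] by (intro mult_left_mono) (auto simp: incseq_def)
      also have "\<dots> \<le> mass\<^sup>2"
        using Tb[of "F n"] by (simp add: rr a FS[symmetric] pos_divide_le_eq)
      finally show ?thesis .
    qed
    ultimately show ?thesis by (smt (verit) measure_nonneg power2_le_imp_le)
  qed
  obtain mu where lim: "r \<longlonglongrightarrow> mu" using incseq_convergent[OF inc] rb by blast
  have "s \<le> r 0" using s pos by (simp add: r_def a_def F0 FS pos_le_divide_eq)
  also have "r 0 \<le> mu" using incseq_le[OF inc lim] by simp
  finally have smu: "s \<le> mu" .
  define u where "u = (\<lambda>n x. (1 / sqrt (a (n + n))) * F n x)"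
  \<comment> \<open>\<open>T\<close> turns the unit normalisation of \<open>u n\<close> into a
    uniform bound and a uniform Lipschitz constant for \<open>v n\<close>, so the limit is taken
    along these images.\<close>
  define v where "v = (\<lambda>n. T (u n))"
  have u [simp]: "u n \<in> C0_unit" for n
    unfolding u_def by (intro C0_unit_scale F)
  have v [simp]: "v n \<in> C0_unit" for n
    unfolding v_def by (intro T_C0_unit u)
  have v_eq: "v n = (\<lambda>x. (1 / sqrt (a (n + n))) * F (Suc n) x)" for n
    by (rule ext) (simp only: v_def u_def T_scale FS)
  have sq: "1 / sqrt (a (n + n)) * (1 / sqrt (a (n + n)) * c) = c / a (n + n)" for n c
    using apos[of "n + n"] by (simp add: field_simps less_imp_le)
  have uu: "ip (u n) (u n) = 1" for n
    unfolding u_def ip_scale ip_scale_right sq a by simp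
  have vu: "ip (v n) (u n) = r (n + n)" for n
    unfolding u_def v_eq ip_scale ip_scale_right sq a by (simp add: r_def)
  have vv: "ip (v n) (v n) = r (n + n) * r (Suc (n + n))" for n
    unfolding v_eq ip_scale ip_scale_right sq a by (simp add: rr)
  have sub: "strict_mono (\<lambda>n::nat. n + n)" "strict_mono (\<lambda>n::nat. Suc (n + n))" by (auto simp: strict_mono_def)
  have lim1: "(\<lambda>n. r (n + n)) \<longlonglongrightarrow> mu" "(\<lambda>n. r (Suc (n + n))) \<longlonglongrightarrow> mu"
    using LIMSEQ_subseq_LIMSEQ[OF lim sub(1)] LIMSEQ_subseq_LIMSEQ[OF lim sub(2)] by (auto simp: o_def)
  \<comment> \<open>Defect of the eigenvalue equation. Its squared seminorm expands into terms that
    tend to \<open>mu * mu\<close>, \<open>- 2 * mu * mu\<close> and \<open>mu * mu\<close>.\<close>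
  define d where "d = (\<lambda>n x. v n x + (- mu) * u n x)"
  have d [simp]: "d n \<in> C0_unit" for n unfolding d_def by (intro C0_unit_add_scale) auto
  have "ip (d n) (d n) = r (n + n) * r (Suc (n + n)) + 2 * (- mu) * r (n + n) + (- mu)\<^sup>2 * 1" for n
    unfolding d_def by (subst ip_square_expand) (auto simp: vv vu uu)
  moreover have "(\<lambda>n. r (n + n) * r (Suc (n + n)) + 2 * (- mu) * r (n + n) + (- mu)\<^sup>2 * 1)
     \<longlonglongrightarrow> mu * mu + 2 * (- mu) * mu + (- mu)\<^sup>2 * 1"
    by (intro tendsto_intros lim1)
  ultimately have dd: "(\<lambda>n. ip (d n) (d n)) \<longlonglongrightarrow> 0" by (simp add: power2_eq_square)
  have Td: "(\<lambda>n. T (d n) x) \<longlonglongrightarrow> 0" for x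
  proof (rule Lim_null_comparison)
    show "(\<lambda>n. sqrt (mass * ip (d n) (d n))) \<longlonglongrightarrow> 0"
      using tendsto_real_sqrt[OF tendsto_mult_left[OF dd, of mass]] by simp
  qed (use T_bound[of "d _" x] in auto)
  obtain g0 k where k: "strict_mono (k :: nat \<Rightarrow> nat)"
    and g0: "\<And>e. 0 < e \<Longrightarrow> \<exists>N. \<forall>n x. n \<ge> N \<and> x \<in> {0..1} \<longrightarrow> norm (v (k n) x - g0 x) < e"
  proof (rule Arzela_Ascoli[of "{0..1::real}" v "sqrt mass"])
    show "norm (v n x) \<le> sqrt mass" for n x
      using T_bound[of "u n" x] by (simp add: v_def uu)
    show "\<exists>dl>0. \<forall>n y. y \<in> {0..1} \<and> norm (x - y) < dl \<longrightarrow> norm (v n x - v n y) < e"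
      if "0 < e" for x e :: real
    proof (intro exI conjI allI impI)
      show "0 < e / (sqrt mass + 1)" using that by (simp add: add_nonneg_pos)
      fix n y assume "y \<in> {0..1} \<and> norm (x - y) < e / (sqrt mass + 1)"
      then have "(sqrt mass + 1) * \<bar>x - y\<bar> < e" 
        by (simp add: pos_less_divide_eq add_nonneg_pos mult.commute)
      moreover have "norm (v n x - v n y) \<le> sqrt mass * \<bar>x - y\<bar>"
        using T_lipschitz[of "u n" x y] by (simp add: v_def uu)
      ultimately show "norm (v n x - v n y) < e" by (simp add: ring_distribs)
    qed
  qed auto
  define g where "g = (\<lambda>x. if x \<in> {0..1} then g0 x else 0)"
  have unif: "\<exists>N. \<forall>n\<ge>N. \<forall>x. \<bar>v (k n) x - g x\<bar> < e" if e: "0 < e" for e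
  proof -
    obtain N where N: "\<forall>n x. n \<ge> N \<and> x \<in> {0..1} \<longrightarrow> norm (v (k n) x - g0 x) < e"
      using g0[OF e] by blast
    then have "\<bar>v (k n) x - g x\<bar> < e" if "n \<ge> N" for n x
      using that e C0_unit_outside[OF v, of x] by (cases "x \<in> {0..1}") (auto simp: g_def)
    then show ?thesis by blast
  qed
  then have ul: "uniform_limit UNIV (\<lambda>n. v (k n)) g sequentially"
    by (auto simp: uniform_limit_sequentially_iff dist_real_def)
  have g: "g \<in> C0_unit"
    unfolding C0_unit_def
    using uniform_limit_theorem[OF _ ul] v by (auto simp: C0_unit_def g_def)
  have vg: "(\<lambda>n. v (k n) x) \<longlonglongrightarrow> g x" for x
    using tendsto_uniform_limitI[OF ul] by simp
  define z where "z = (\<lambda>n x. v (k n) x + (- 1) * g x)"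
  have z [simp]: "z n \<in> C0_unit" for n unfolding z_def by (intro C0_unit_add_scale v g)
  have zz: "(\<lambda>n. ip (z n) (z n)) \<longlonglongrightarrow> 0"
  proof (rule LIMSEQ_I)
    fix e :: real assume e: "0 < e"
    define e' where "e' = sqrt (e / (mass + 1))"
    have e': "0 < e'" using e by (simp add: e'_def add_nonneg_pos)
    obtain N where N: "\<forall>n\<ge>N. \<forall>x. \<bar>v (k n) x - g x\<bar> < e'" using unif[OF e'] by blast
    have "norm (ip (z n) (z n) - 0) < e" if "n \<ge> N" for n
    proof -
      have "\<bar>z n x\<bar> \<le> e'" for x using N that by (auto simp: z_def intro: less_imp_le)
      then have "ip (z n) (z n) \<le> e'\<^sup>2 * mass" by (intro ip_le_sup) auto
      also have "\<dots> < e'\<^sup>2 * (mass + 1)" using e' by simp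
      also have "\<dots> = e"
      proof -
        have "0 < mass + 1" by (simp add: add_nonneg_pos)
        then show ?thesis using e by (simp add: e'_def)
      qed
      finally show ?thesis using ip_nonneg[of "z n"] by simp
    qed
    then show "\<exists>N. \<forall>n\<ge>N. norm (ip (z n) (z n) - 0) < e" by blast
  qed
  have zh: "(\<lambda>n. ip (z n) h) \<longlonglongrightarrow> 0" if h: "h \<in> C0_unit" for h
  proof (rule Lim_null_comparison)
    show "(\<lambda>n. sqrt (ip (z n) (z n) * ip h h)) \<longlonglongrightarrow> 0"
      using tendsto_real_sqrt[OF tendsto_mult_right[OF zz, of "ip h h"]] by simp
    have "norm (ip (z n) h) \<le> sqrt (ip (z n) (z n) * ip h h)" for n
      using real_sqrt_le_mono[OF ip_Cauchy_Schwarz[OF z[of n] h]] by simp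
    then show "\<forall>\<^sub>F n in sequentially. norm (ip (z n) h) \<le> sqrt (ip (z n) (z n) * ip h h)" by simp
  qed
  have veq: "v (k n) = (\<lambda>x. g x + 1 * z n x)" for n by (auto simp: z_def)
  \<comment> \<open>As \<open>v n = T (u n)\<close>, the eigenvalue defect of \<open>v n\<close> is
    \<open>T (d n)\<close>, which tends to 0 pointwise.\<close>
  have Tg: "T g x = mu * g x" for x
  proof -
    have "(\<lambda>n. T (z n) x) \<longlonglongrightarrow> 0"
    proof (rule Lim_null_comparison)
      show "(\<lambda>n. sqrt (mass * ip (z n) (z n))) \<longlonglongrightarrow> 0"
        using tendsto_real_sqrt[OF tendsto_mult_left[OF zz, of mass]] by simp
    qed (use T_bound[of "z _" x] in auto)
    then have "(\<lambda>n. T g x + 1 * T (z n) x - mu * v (k n) x) \<longlonglongrightarrow> T g x + 1 * 0 - mu * g x"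
      by (intro tendsto_intros vg)
    moreover have "T g x + 1 * T (z n) x - mu * v (k n) x = T (d (k n)) x" for n
    proof -
      have "T (d (k n)) x = T (v (k n)) x + (- mu) * v (k n) x"
        unfolding d_def by (subst T_add_scale[OF v u]) (simp add: v_def)
      also have "T (v (k n)) x = T g x + 1 * T (z n) x"
        unfolding veq by (rule T_add_scale[OF g z])
      finally show ?thesis by simp
    qed
    moreover have "(\<lambda>n. T (d (k n)) x) \<longlonglongrightarrow> 0"
      using LIMSEQ_subseq_LIMSEQ[OF Td k] by (simp add: o_def)
    ultimately show ?thesis using LIMSEQ_unique by fastforce
  qed
  \<comment> \<open>The limit of the squared seminorms of \<open>v n\<close>; being positive, it
    keeps \<open>g\<close> from degenerating.\<close>
  have gg: "ip g g = mu * mu"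
  proof -
    have "ip (v (k n)) (v (k n)) = ip g g + 2 * 1 * ip (z n) g + 1\<^sup>2 * ip (z n) (z n)" for n
      unfolding veq by (subst ip_square_expand) (auto simp: g ip_sym)
    moreover have "(\<lambda>n. ip g g + 2 * 1 * ip (z n) g + 1\<^sup>2 * ip (z n) (z n)) \<longlonglongrightarrow> ip g g + 2 * 1 * 0 + 1\<^sup>2 * 0"
      by (intro tendsto_intros zh zz g)
    ultimately have "(\<lambda>n. ip (v (k n)) (v (k n))) \<longlonglongrightarrow> ip g g" by simp
    moreover have "(\<lambda>n. ip (v n) (v n)) \<longlonglongrightarrow> mu * mu"
      unfolding vv by (intro tendsto_intros lim1)
    ultimately show ?thesis
      using LIMSEQ_subseq_LIMSEQ[OF _ k, of "\<lambda>n. ip (v n) (v n)"] LIMSEQ_unique by (auto simp: o_def)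
  qed
  \<comment> \<open>For \<open>lam\<close> not 0, self-adjointness carries orthogonality to
    \<open>e\<close> from \<open>f\<close> to all iterates; for \<open>lam = 0\<close> every product
    with \<open>e\<close> vanishes.\<close>
  have orth: "ip g e = 0" if e: "e \<in> eigenspace \<nu> lam" and fe: "ip f e = 0" for e lam
  proof (cases "lam = 0")
    case True
    then show ?thesis using ip_eigenspace[OF e, of g] by (simp add: ip_sym)
  next
    case False
    have eC: "e \<in> C0_unit" by (rule eigenspace_C0_unit[OF e])
    have "ip (F n) e = 0" for n
    proof (induction n)
      case (Suc n)
      have "lam * ip (F (Suc n)) e = ip (F n) e"
        using ip_eigenspace[OF e, of "F n"] T_selfadjoint[OF F eC, of n] by (simp add: FS ip_sym)
      then show ?case using False Suc by simp
    qed (simp add: F0 fe)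
    then have "ip (v n) e = 0" for n unfolding v_eq ip_scale by simp
    moreover have "ip (v (k n)) e = ip g e + 1 * ip (z n) e" for n
      unfolding veq by (rule ip_add_scale[OF g z eC])
    ultimately have "ip (z n) e = - ip g e" for n by (metis add_eq_0_iff mult_1 add.commute)
    then show ?thesis using zh[OF eC] by (simp add: LIMSEQ_const_iff)
  qed
  show ?thesis
    using that[OF g smu Tg _ orth] gg smu pos by simp
qed

end

section \<open>Counting eigenvalues\<close>

interpretation fun_space: vector_space fun_scale
  by (rule vector_space_fun_scale)

lemma sum_fun_scale_apply: "(\<Sum>e\<in>S. fun_scale (c e) e) x = (\<Sum>e\<in>S. c e * e x)"
  by (induction S rule: infinite_finite_induct) (auto simp: fun_scale_def)

context unit_measure
begin

section \<open>Maximal orthonormal systems of eigenfunctions\<close>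

lemma Bessel:
  assumes S: "finite S" "S \<subseteq> C0_unit" and h: "h \<in> C0_unit"
    and orth: "\<And>e e'. e \<in> S \<Longrightarrow> e' \<in> S \<Longrightarrow> ip e e' = (if e = e' then 1 else 0)"
  shows "(\<Sum>e\<in>S. (ip h e)\<^sup>2) \<le> ip h h"
proof -
  define s where "s = (\<lambda>x. \<Sum>e\<in>S. ip h e * e x)"
  have s: "s \<in> C0_unit" unfolding s_def using S by (intro C0_unit_sum) auto
  have sg: "ip s g = (\<Sum>e\<in>S. ip h e * ip e g)" if "g \<in> C0_unit" for g
    unfolding s_def using S that by (intro ip_sum) auto
  have sh: "ip s h = (\<Sum>e\<in>S. (ip h e)\<^sup>2)"
    unfolding sg[OF h] by (simp add: ip_sym[of _ h] power2_eq_square)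
  have "ip s e = ip h e" if "e \<in> S" for e
  proof -
    have "ip s e = (\<Sum>e'\<in>S. if e' = e then ip h e' else 0)"
      unfolding sg[OF subsetD[OF S(2) that]] using that by (intro sum.cong) (auto simp: orth)
    then show ?thesis using S(1) that by simp
  qed
  then have ss: "ip s s = (\<Sum>e\<in>S. (ip h e)\<^sup>2)"
    unfolding sg[OF s] by (auto simp: ip_sym[of _ s] power2_eq_square intro!: sum.cong)
  have "0 \<le> ip (\<lambda>x. h x + (- 1) * s x) (\<lambda>x. h x + (- 1) * s x)" by (rule ip_nonneg)
  also have "\<dots> = ip h h + 2 * (- 1) * ip h s + (- 1)\<^sup>2 * ip s s"
    by (rule ip_square_expand[OF h s])
  also have "\<dots> = ip h h - (\<Sum>e\<in>S. (ip h e)\<^sup>2)"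
    by (simp add: ss ip_sym[of h s] sh)
  finally show ?thesis by simp
qed

text \<open>Unit seminorm excludes the zero function, so the eigenvalues involved are positive
  although \<open>{..x}\<close> is unbounded below. Finiteness is demanded because
  \<open>card\<close> of an infinite set is 0.\<close>

definition eigen_system :: "real \<Rightarrow> (real \<Rightarrow> real) set \<Rightarrow> bool" where
  "eigen_system x S \<longleftrightarrow> finite S \<and> S \<subseteq> (\<Union>lam\<in>{..x}. eigenspace \<nu> lam) \<and>
     (\<forall>e\<in>S. \<forall>e'\<in>S. ip e e' = (if e = e' then 1 else 0))"

lemma eigen_system_C0_unit: "eigen_system x S \<Longrightarrow> e \<in> S \<Longrightarrow> e \<in> C0_unit"
  by (auto simp: eigen_system_def intro: eigenspace_C0_unit)

lemma ip_one_nonzero: "ip e e = 1 \<Longrightarrow> e \<noteq> (\<lambda>x. 0)"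
  by (auto simp: ip_def)

text \<open>Bessel's inequality for \<open>green x\<close>, integrated over \<open>x\<close>, is the trace bound that makes the
  eigenvalue count finite.\<close>

lemma eigen_system_card_le:
  assumes S: "eigen_system x S"
  shows "real (card S) \<le> x\<^sup>2 * mass\<^sup>2"
proof -
  have fin: "finite S" and SC: "S \<subseteq> C0_unit"
    and orth: "\<And>e e'. e \<in> S \<Longrightarrow> e' \<in> S \<Longrightarrow> ip e e' = (if e = e' then 1 else 0)"
    using S eigen_system_C0_unit[OF S] by (auto simp: eigen_system_def)
  have pt: "(\<Sum>e\<in>S. e t * e t) \<le> x\<^sup>2 * mass" for t
  proof (cases "t \<in> {0..1}")
    case True
    have g: "green t \<in> C0_unit" by (rule green_C0_unit[OF True])
    \<comment> \<open>The fixed point equation reads \<open>e t = lam * ip (green t) e\<close>, so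
      the sum over \<open>e\<close> is a Bessel sum for \<open>green t\<close>; positivity of
      \<open>lam\<close> allows squaring \<open>lam <= x\<close>.\<close>
    have "(e t)\<^sup>2 \<le> x\<^sup>2 * (ip (green t) e)\<^sup>2" if e: "e \<in> S" for e
    proof -
      obtain lam where lam: "lam \<le> x" "e \<in> eigenspace \<nu> lam"
        using S e by (auto simp: eigen_system_def)
      have "0 < lam" using eigenspace_nonzero(2)[OF lam(2)] ip_one_nonzero orth[OF e e] by auto
      then have "lam\<^sup>2 \<le> x\<^sup>2" using lam(1) by (simp add: power_mono)
      moreover have "e t = lam * ip (green t) e"
        using eigenspace_imp_fixed[OF lam(2)] by (simp add: T_eq_ip)
      ultimately show ?thesis by (simp add: power_mult_distrib mult_right_mono)
    qed
    then have "(\<Sum>e\<in>S. (e t)\<^sup>2) \<le> (\<Sum>e\<in>S. x\<^sup>2 * (ip (green t) e)\<^sup>2)" by (rule sum_mono)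
    also have "\<dots> = x\<^sup>2 * (\<Sum>e\<in>S. (ip (green t) e)\<^sup>2)" by (simp add: sum_distrib_left)
    also have "\<dots> \<le> x\<^sup>2 * ip (green t) (green t)"
      by (intro mult_left_mono Bessel fin SC g orth) auto
    also have "\<dots> \<le> x\<^sup>2 * (1\<^sup>2 * mass)"
    proof (intro mult_left_mono ip_le_sup g)
      show "\<bar>green t y\<bar> \<le> 1" for y
        using green_abs_le[of y t] green_outside'[OF True, of y] by (cases "y \<in> {0..1}") auto
    qed simp
    finally show ?thesis by (simp add: power2_eq_square)
  next
    case False
    then have "(\<Sum>e\<in>S. e t * e t) = 0"
      using SC C0_unit_outside by (intro sum.neutral) auto
    then show ?thesis by simp
  qed
  have i: "integrable \<nu> (\<lambda>t. e t * e t)" if "e \<in> S" for e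
    using that SC integrable_mult_nu by auto
  have "real (card S) = (\<Sum>e\<in>S. ip e e)" using orth by simp
  also have "\<dots> = (LINT t|\<nu>. (\<Sum>e\<in>S. e t * e t))"
    unfolding ip_def using i by (subst Bochner_Integration.integral_sum) auto
  also have "\<dots> \<le> (LINT t|\<nu>. x\<^sup>2 * mass)"
    using i by (intro integral_mono pt) auto
  also have "\<dots> = x\<^sup>2 * mass\<^sup>2" by (simp add: power2_eq_square)
  finally show ?thesis .
qed

lemma exists_maximal_eigen_system:
  obtains S where "eigen_system x S" "\<And>S'. eigen_system x S' \<Longrightarrow> card S' \<le> card S"
proof -
  have "\<exists>S. eigen_system x S \<and> (\<forall>S'. eigen_system x S' \<longrightarrow> card S' \<le> card S)"
  proof (rule ex_has_greatest_nat[of "eigen_system x" "{}" card "nat \<lceil>x\<^sup>2 * mass\<^sup>2\<rceil> + 1"])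
    show "eigen_system x {}" by (simp add: eigen_system_def)
    show "\<forall>S. eigen_system x S \<longrightarrow> card S < nat \<lceil>x\<^sup>2 * mass\<^sup>2\<rceil> + 1"
    proof (intro allI impI)
      fix S assume "eigen_system x S"
      from eigen_system_card_le[OF this] show "card S < nat \<lceil>x\<^sup>2 * mass\<^sup>2\<rceil> + 1" by linarith
    qed
  qed
  then show ?thesis using that by blast
qed

lemma maximal_eigen_system_complete:
  assumes S: "eigen_system x S" and max: "\<And>S'. eigen_system x S' \<Longrightarrow> card S' \<le> card S"
    and f: "f \<in> eigenspace \<nu> lam" "lam \<le> x" and orth: "\<And>e. e \<in> S \<Longrightarrow> ip f e = 0"
  shows "f = (\<lambda>x. 0)"
proof (rule ccontr)
  assume "f \<noteq> (\<lambda>x. 0)"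
  then have pos: "0 < ip f f" by (rule eigenspace_nonzero[OF f(1)])
  define g where "g = (\<lambda>t. (1 / sqrt (ip f f)) * f t)"
  have g: "g \<in> eigenspace \<nu> lam" unfolding g_def by (rule eigenspace_scale[OF f(1)])
  have gg: "ip g g = 1" unfolding g_def ip_scale ip_scale_right using pos by (simp add: field_simps)
  have ge: "ip g e = 0" if "e \<in> S" for e unfolding g_def ip_scale using orth[OF that] by simp
  then have "g \<notin> S" using gg by fastforce
  moreover have "eigen_system x (insert g S)"
    using S g gg ge f(2) \<open>g \<notin> S\<close> by (auto simp: eigen_system_def ip_sym)
  ultimately show False using max[of "insert g S"] S by (simp add: eigen_system_def)
qed

text \<open>The members of \<open>S\<close> in one eigenspace form a basis of it: orthonormality
  gives independence, and the residue of a projection is orthogonal to these members by construction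
  and to the others as they belong to different eigenvalues, so maximality makes it 0.\<close>

lemma eigenvalue_count_eq_card:
  assumes S: "eigen_system x S" and max: "\<And>S'. eigen_system x S' \<Longrightarrow> card S' \<le> card S"
  shows "eigenvalue_count \<nu> x = card S"
proof -
  have fin: "finite S" and orth: "\<And>e e'. e \<in> S \<Longrightarrow> e' \<in> S \<Longrightarrow> ip e e' = (if e = e' then 1 else 0)"
    using S by (auto simp: eigen_system_def)
  have nz: "e \<noteq> (\<lambda>x. 0)" if "e \<in> S" for e using orth[OF that that] ip_one_nonzero by simp
  define E where "E = (\<lambda>lam. S \<inter> eigenspace \<nu> lam)"
  define L where "L = {lam. is_eigenvalue \<nu> lam \<and> lam \<le> x}"
  have disj: "E lam \<inter> E mu = {}" if "lam \<noteq> mu" for lam mu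
    using eigenspace_orthogonal[OF _ _ that] orth by (auto simp: E_def) fastforce
  have finE: "finite (E lam)" for lam using fin by (simp add: E_def)
  have ind: "fun_space.independent (E lam)" for lam
  proof
    assume "fun_space.dependent (E lam)"
    then obtain u where u: "\<exists>v\<in>E lam. u v \<noteq> 0" "(\<Sum>v\<in>E lam. fun_scale (u v) v) = 0"
      using fun_space.dependent_finite[OF finE] by auto
    then obtain v where v: "v \<in> E lam" "u v \<noteq> 0" by blast
    have vC: "v \<in> C0_unit" using v eigen_system_C0_unit[OF S] by (auto simp: E_def)
    have z: "(\<lambda>t. \<Sum>e\<in>E lam. u e * e t) = (\<lambda>t. 0)"
      using fun_cong[OF u(2)] by (simp add: sum_fun_scale_apply)
    have "ip (\<lambda>t. \<Sum>e\<in>E lam. u e * e t) v = (\<Sum>e\<in>E lam. u e * ip e v)"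
      using eigen_system_C0_unit[OF S] vC by (intro ip_sum) (auto simp: E_def)
    also have "\<dots> = (\<Sum>e\<in>E lam. if e = v then u e else 0)"
      using v orth by (intro sum.cong) (auto simp: E_def)
    also have "\<dots> = u v" using v finE by simp
    finally show False using v unfolding z by (simp add: ip_def)
  qed
  have span: "eigenspace \<nu> lam \<subseteq> fun_space.span (E lam)" if lam: "lam \<le> x" for lam
  proof
    fix f assume f: "f \<in> eigenspace \<nu> lam"
    have fC: "f \<in> C0_unit" by (rule eigenspace_C0_unit[OF f])
    define p where "p = (\<lambda>t. \<Sum>e\<in>E lam. ip f e * e t)"
    have p: "p \<in> eigenspace \<nu> lam" unfolding p_def by (intro eigenspace_sum) (auto simp: E_def)
    define r where "r = (\<lambda>t. f t + (- 1) * p t)"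
    have r: "r \<in> eigenspace \<nu> lam" unfolding r_def by (intro eigenspace_add_scale f p)
    have "ip r e = 0" if e: "e \<in> S" for e
    proof (cases "e \<in> E lam")
      case True
      have eC: "e \<in> C0_unit" using e eigen_system_C0_unit[OF S] by auto
      have "ip p e = (\<Sum>e'\<in>E lam. ip f e' * ip e' e)"
        unfolding p_def using eigen_system_C0_unit[OF S] eC by (intro ip_sum) (auto simp: E_def)
      also have "\<dots> = (\<Sum>e'\<in>E lam. if e' = e then ip f e' else 0)"
        using e orth by (intro sum.cong) (auto simp: E_def)
      also have "\<dots> = ip f e" using True finE by simp
      finally show ?thesis
        unfolding r_def by (subst ip_add_scale[OF fC eigenspace_C0_unit[OF p] eC]) simp
    next
      case False
      obtain mu where mu: "e \<in> eigenspace \<nu> mu" using S e by (auto simp: eigen_system_def)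
      then have "lam \<noteq> mu" using False e by (auto simp: E_def)
      then show ?thesis by (rule eigenspace_orthogonal[OF r mu])
    qed
    then have "r = (\<lambda>t. 0)" using maximal_eigen_system_complete[OF S max r lam] by blast
    then have "f = (\<Sum>e\<in>E lam. fun_scale (ip f e) e)"
      by (auto simp: fun_eq_iff r_def p_def sum_fun_scale_apply)
    also have "\<dots> \<in> fun_space.span (E lam)"
      by (intro fun_space.span_sum fun_space.span_scale fun_space.span_base)
    finally show "f \<in> fun_space.span (E lam)" .
  qed
  have mult: "eigenvalue_multiplicity \<nu> lam = card (E lam)" if "lam \<in> L" for lam
    unfolding eigenvalue_multiplicity_def
    by (rule fun_space.dim_unique[OF _ span ind]) (use that in \<open>auto simp: E_def L_def\<close>)
  have ne: "E lam \<noteq> {}" if lam: "lam \<in> L" for lam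
  proof
    assume "E lam = {}"
    then have "eigenspace \<nu> lam \<subseteq> {0}" using span[of lam] lam by (auto simp: L_def)
    then show False using lam by (auto simp: L_def is_eigenvalue_def fun_eq_iff)
  qed
  \<comment> \<open>Distinct eigenvalues own disjoint nonempty parts of \<open>S\<close>. For
    infinite \<open>L\<close> the sum in \<open>eigenvalue_count\<close> would be 0 by
    convention.\<close>
  have finL: "finite L"
  proof (rule finite_imageD)
    show "finite (E ` L)" by (rule finite_subset[of _ "Pow S"]) (auto simp: E_def fin)
    show "inj_on E L" using ne disj by (intro inj_onI) (metis Int_absorb)
  qed
  have SU: "S = (\<Union>lam\<in>L. E lam)"
    using S nz by (fastforce simp: eigen_system_def E_def L_def is_eigenvalue_def)
  have "eigenvalue_count \<nu> x = (\<Sum>lam\<in>L. card (E lam))"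
    unfolding eigenvalue_count_def L_def[symmetric] using mult by simp
  also have "\<dots> = card S"
    unfolding SU using finL finE disj by (subst card_UN_disjoint) auto
  finally show ?thesis .
qed

text \<open>Half of the min-max principle, by contradiction: if a maximal system had fewer than
  \<open>card I\<close> members, a nontrivial combination of the \<open>h i\<close> would be
  orthogonal to it, and power iteration from there would yield an eigenfunction that the system
  misses.\<close>

lemma eigenvalue_count_ge:
  assumes I: "finite I" and x: "0 < x" and h: "\<And>i. i \<in> I \<Longrightarrow> h i \<in> C0_unit"
    and pos: "\<And>c. \<exists>i\<in>I. c i \<noteq> 0 \<Longrightarrow> 0 < ip (\<lambda>t. \<Sum>i\<in>I. c i * h i t) (\<lambda>t. \<Sum>i\<in>I. c i * h i t)"
    and large: "\<And>c. ip (\<lambda>t. \<Sum>i\<in>I. c i * h i t) (\<lambda>t. \<Sum>i\<in>I. c i * h i t)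
      \<le> x * ip (T (\<lambda>t. \<Sum>i\<in>I. c i * h i t)) (\<lambda>t. \<Sum>i\<in>I. c i * h i t)"
  shows "card I \<le> eigenvalue_count \<nu> x"
proof (rule ccontr)
  obtain S where S: "eigen_system x S" and max: "\<And>S'. eigen_system x S' \<Longrightarrow> card S' \<le> card S"
    using exists_maximal_eigen_system by blast
  assume "\<not> card I \<le> eigenvalue_count \<nu> x"
  then have less: "card S < card I" using eigenvalue_count_eq_card[OF S max] by simp
  have fin: "finite S" using S by (simp add: eigen_system_def)
  obtain c where c: "\<exists>i\<in>I. c i \<noteq> 0" "\<forall>e\<in>S. (\<Sum>i\<in>I. c i * ip (h i) e) = 0"
    using exists_nontrivial_kernel[OF I fin less, of "\<lambda>i e. ip (h i) e"] by blast
  define f where "f = (\<lambda>t. \<Sum>i\<in>I. c i * h i t)"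
  have f: "f \<in> C0_unit" unfolding f_def by (intro C0_unit_sum h)
  have fe: "ip f e = 0" if "e \<in> S" for e
    unfolding f_def using c(2) that h eigen_system_C0_unit[OF S that] by (subst ip_sum) auto
  have "0 < ip f f" using pos[OF c(1)] by (simp add: f_def)
  moreover have "(1 / x) * ip f f \<le> ip (T f) f"
    using large[of c] x by (simp add: f_def pos_divide_le_eq mult.commute)
  ultimately obtain g mu where g: "g \<in> C0_unit" "1 / x \<le> mu" "\<And>t. T g t = mu * g t" "0 < ip g g"
    and orth: "\<And>e lam. e \<in> eigenspace \<nu> lam \<Longrightarrow> ip f e = 0 \<Longrightarrow> ip g e = 0"
    using exists_eigenfunction[OF f, of "1 / x"] x by auto
  have mu: "0 < mu" using g(2) x by (meson divide_pos_pos less_le_trans zero_less_one)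
  \<comment> \<open>Eigenvalues of the form are reciprocals of those of \<open>T\<close>, so
    \<open>1 / x <= mu\<close> makes this one at most \<open>x\<close>.\<close>
  have "g \<in> eigenspace \<nu> (1 / mu)" using mu g by (intro fixed_imp_eigenspace) auto
  moreover have "1 / mu \<le> x" using mu x g(2) by (simp add: field_simps)
  moreover have "ip g e = 0" if e: "e \<in> S" for e
    using S e orth fe[OF e] by (auto simp: eigen_system_def)
  ultimately have "g = (\<lambda>t. 0)" using maximal_eigen_system_complete[OF S max] by blast
  then show False using g(4) by (simp add: ip_def)
qed

end

section \<open>Test functions\<close>

definition ramp :: "real \<Rightarrow> real \<Rightarrow> real" where
  "ramp s x = max 0 (x - s)"

text \<open>A trapezoid with plateau 1 on \<open>[a, a + L]\<close> and flanks of width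
  \<open>L / 2\<close>, hence of total width \<open>2 * L\<close>: tents with parameters
  \<open>2 * L\<close> apart do not overlap. Continuity and gradient are at sight in a sum of
  ramps.\<close>

definition tent :: "real \<Rightarrow> real \<Rightarrow> real \<Rightarrow> real" where
  "tent L a x = 2 / L * (ramp (a - L / 2) x - ramp a x - ramp (a + L) x + ramp (a + 3 * L / 2) x)"

text \<open>Half-open flanks keep the gradients of two touching tents disjoint even at the common
  endpoint.\<close>

definition tent_grad :: "real \<Rightarrow> real \<Rightarrow> real \<Rightarrow> real" where
  "tent_grad L a x = 2 / L * (indicator {a - L / 2<..a} x - indicator {a + L<..a + 3 * L / 2} x)"

lemma tent_outside: "0 < L \<Longrightarrow> x \<notin> {a - L / 2<..<a + 3 * L / 2} \<Longrightarrow> tent L a x = 0"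
  by (auto simp: tent_def ramp_def max_def)

lemma tent_inside: "0 < L \<Longrightarrow> x \<in> {a..a + L} \<Longrightarrow> tent L a x = 1"
  by (auto simp: tent_def ramp_def max_def)

lemma tent_grad_outside: "0 < L \<Longrightarrow> x \<notin> {a - L / 2<..a + 3 * L / 2} \<Longrightarrow> tent_grad L a x = 0"
  by (auto simp: tent_grad_def indicator_def)

lemma tent_mult_zero: "0 < L \<Longrightarrow> 2 * L \<le> \<bar>a - b\<bar> \<Longrightarrow> tent L a x * tent L b x = 0"
  using tent_outside[of L x a] tent_outside[of L x b]
  by (cases "x \<in> {a - L / 2<..<a + 3 * L / 2}"; cases "x \<in> {b - L / 2<..<b + 3 * L / 2}") auto

lemma tent_grad_mult_zero: "0 < L \<Longrightarrow> 2 * L \<le> \<bar>a - b\<bar> \<Longrightarrow> tent_grad L a x * tent_grad L b x = 0"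
  using tent_grad_outside[of L x a] tent_grad_outside[of L x b]
  by (cases "x \<in> {a - L / 2<..a + 3 * L / 2}"; cases "x \<in> {b - L / 2<..b + 3 * L / 2}") auto

lemma tent_C0_unit:
  assumes "0 < L" "0 \<le> a - L / 2" "a + 3 * L / 2 \<le> 1"
  shows "tent L a \<in> C0_unit"
  unfolding C0_unit_def
proof (intro CollectI conjI allI impI)
  show "continuous_on UNIV (tent L a)"
    unfolding tent_def[abs_def] ramp_def by (intro continuous_intros)
  show "tent L a x = 0" if "x \<notin> {0..1}" for x
    using that assms by (intro tent_outside) auto
qed

lemma tent_grad_bound: "0 < L \<Longrightarrow> \<bar>tent_grad L a x\<bar> \<le> 2 / L"
  by (auto simp: tent_grad_def indicator_def)

lemma tent_grad_measurable [measurable]: "tent_grad L a \<in> borel_measurable borel"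
  unfolding tent_grad_def[abs_def] by measurable

lemma tent_grad_L2_unit: "0 < L \<Longrightarrow> L2_unit (tent_grad L a)"
  by (rule L2_unit_bounded[OF tent_grad_measurable tent_grad_bound])

lemma primitive_indicator:
  assumes "0 \<le> s" "s \<le> t"
  shows "primitive (indicator {s<..t}) x = ramp s x - ramp t x"
proof -
  have "primitive (indicator {s<..t}) x = (LINT y|lborel. indicator {s<..min t x} y)"
    unfolding primitive_def set_lebesgue_integral_def using assms
    by (intro Bochner_Integration.integral_cong) (auto simp: indicator_def)
  also have "\<dots> = measure lborel {s<..min t x}" by simp
  also have "\<dots> = ramp s x - ramp t x"
    using assms by (cases "s \<le> min t x") (auto simp: ramp_def)
  finally show ?thesis .
qed

lemma tent_weak_gradient:
  assumes "0 < L" "0 \<le> a - L / 2"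
  shows "is_weak_gradient (tent L a) (tent_grad L a)"
proof -
  let ?u = "indicator {a - L / 2<..a} :: real \<Rightarrow> real"
  let ?v = "indicator {a + L<..a + 3 * L / 2} :: real \<Rightarrow> real"
  have L: "L2_unit ?u" "L2_unit ?v"
    by (auto intro!: L2_unit_bounded[where K=1] simp: indicator_def)
  have "tent L a x = primitive (tent_grad L a) x" if x: "x \<in> {0..1}" for x
  proof -
    have "primitive (tent_grad L a) x = 2 / L * primitive (\<lambda>t. ?u t + (-1) * ?v t) x"
      unfolding primitive_def tent_grad_def[abs_def] set_integral_mult_right by simp
    also have "primitive (\<lambda>t. ?u t + (-1) * ?v t) x = primitive ?u x + (-1) * primitive ?v x"
      using x by (intro primitive_add_scale L) auto
    finally show ?thesis using assms by (simp add: primitive_indicator tent_def)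
  qed
  then show ?thesis using tent_grad_L2_unit[OF assms(1)] by (simp add: is_weak_gradient_iff primitive_def)
qed

text \<open>Slope \<open>2 / L\<close> on flanks of total length \<open>L\<close>; what lies outside
  [0,1] is dropped.\<close>

lemma tent_energy:
  assumes "0 < L"
  shows "(LINT x:{0..1}|lborel. (tent_grad L a x)\<^sup>2) \<le> 4 / L"
proof -
  let ?A = "{a - L / 2<..a} \<union> {a + L<..a + 3 * L / 2}"
  have fin: "emeasure lborel ?A = ennreal L"
    using assms by (subst plus_emeasure[symmetric]) (auto simp: ennreal_plus[symmetric] simp del: ennreal_plus)
  have i: "integrable lborel (\<lambda>x. 4 / L\<^sup>2 * indicator ?A x)"
    by (intro integrable_mult_right) (simp add: integrable_indicator_iff fin)
  have "(LINT x:{0..1}|lborel. (tent_grad L a x)\<^sup>2) \<le> (LINT x|lborel. 4 / L\<^sup>2 * indicator ?A x)"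
    unfolding set_lebesgue_integral_def
  proof (rule integral_mono[OF _ i])
    show "integrable lborel (\<lambda>x. indicator {0..1} x *\<^sub>R (tent_grad L a x)\<^sup>2)"
      using tent_grad_L2_unit[OF assms] by (simp add: L2_unit_def set_integrable_def)
    show "indicator {0..1} x *\<^sub>R (tent_grad L a x)\<^sup>2 \<le> 4 / L\<^sup>2 * indicator ?A x" for x
      using assms by (auto simp: tent_grad_def indicator_def power2_eq_square)
  qed
  also have "\<dots> = 4 / L\<^sup>2 * L" using fin assms by (simp add: measure_def)
  also have "\<dots> = 4 / L" using assms by (simp add: power2_eq_square)
  finally show ?thesis .
qed

lemma sum_square_disjoint:
  fixes g :: "'a \<Rightarrow> real"
  assumes "finite A" "\<And>a b. a \<in> A \<Longrightarrow> b \<in> A \<Longrightarrow> a \<noteq> b \<Longrightarrow> g a * g b = 0"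
  shows "(\<Sum>a\<in>A. c a * g a)\<^sup>2 = (\<Sum>a\<in>A. (c a)\<^sup>2 * (g a)\<^sup>2)"
proof -
  have "(\<Sum>a\<in>A. c a * g a)\<^sup>2 = (\<Sum>a\<in>A. \<Sum>b\<in>A. (c a * g a) * (c b * g b))"
    by (simp add: power2_eq_square sum_product)
  also have "\<dots> = (\<Sum>a\<in>A. \<Sum>b\<in>A. if b = a then (c a)\<^sup>2 * (g a)\<^sup>2 else 0)"
  proof (intro sum.cong refl)
    fix a b assume ab: "a \<in> A" "b \<in> A"
    have "(c a * g a) * (c b * g b) = c a * c b * (g a * g b)" by (simp add: mult_ac)
    then show "(c a * g a) * (c b * g b) = (if b = a then (c a)\<^sup>2 * (g a)\<^sup>2 else 0)"
      using assms(2)[OF ab] by (auto simp: power2_eq_square)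
  qed
  also have "\<dots> = (\<Sum>a\<in>A. (c a)\<^sup>2 * (g a)\<^sup>2)" using assms(1) by simp
  finally show ?thesis .
qed

lemma is_weak_gradient_sum:
  assumes "\<And>i. i \<in> I \<Longrightarrow> is_weak_gradient (f i) (w i)"
  shows "is_weak_gradient (\<lambda>x. \<Sum>i\<in>I. c i * f i x) (\<lambda>x. \<Sum>i\<in>I. c i * w i x)"
  using assms
proof (induction I rule: infinite_finite_induct)
  case (insert i I)
  then have "is_weak_gradient (\<lambda>x. (\<Sum>i\<in>I. c i * f i x) + c i * f i x) (\<lambda>x. (\<Sum>i\<in>I. c i * w i x) + c i * w i x)"
    by (intro is_weak_gradient_add_scale) auto
  then show ?case using insert by (simp add: add.commute)
qed (auto simp: is_weak_gradient_zero)

text \<open>Disjoint tents make both quadratic forms diagonal: \<open>ip\<close> is at least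
  \<open>m\<close> times the sum of the squared coefficients, mass under the flanks only helping,
  and the energy is at most \<open>4 / L\<close> times that sum.\<close>

lemma (in unit_measure) eigenvalue_count_ge_card_intervals:
  assumes fin: "finite A" and L: "0 < L" and m: "0 < m"
    and A: "\<And>a. a \<in> A \<Longrightarrow> 0 \<le> a - L / 2 \<and> a + 3 * L / 2 \<le> 1"
    and sep: "\<And>a b. a \<in> A \<Longrightarrow> b \<in> A \<Longrightarrow> a \<noteq> b \<Longrightarrow> 2 * L \<le> \<bar>a - b\<bar>"
    and mass: "\<And>a. a \<in> A \<Longrightarrow> m \<le> measure \<nu> {a<..a + L}"
    and x: "4 / (L * m) \<le> x"
  shows "card A \<le> eigenvalue_count \<nu> x"
proof -
  have C0: "tent L a \<in> C0_unit" if "a \<in> A" for a using A[OF that] L by (intro tent_C0_unit) auto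
  define f where "f = (\<lambda>c t. \<Sum>a\<in>A. c a * tent L a t)"
  have f: "f c \<in> C0_unit" for c unfolding f_def by (intro C0_unit_sum C0)
  have lower: "m * (\<Sum>a\<in>A. (c a)\<^sup>2) \<le> ip (f c) (f c)" for c
  proof -
    have "m * (\<Sum>a\<in>A. (c a)\<^sup>2) \<le> (\<Sum>a\<in>A. (c a)\<^sup>2 * measure \<nu> {a<..a + L})"
      unfolding sum_distrib_left by (intro sum_mono) (subst mult.commute, intro mult_left_mono mass, auto)
    also have "\<dots> = (LINT t|\<nu>. (\<Sum>a\<in>A. (c a)\<^sup>2 * indicator {a<..a + L} t))"
      by (subst Bochner_Integration.integral_sum) (auto simp: emeasure_eq_measure integrable_indicator_iff)
    also have "\<dots> \<le> ip (f c) (f c)"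
      unfolding ip_def
    proof (rule integral_mono)
      show "integrable \<nu> (\<lambda>t. \<Sum>a\<in>A. (c a)\<^sup>2 * indicator {a<..a + L} t)"
        by (intro Bochner_Integration.integrable_sum integrable_mult_right)
          (auto simp: integrable_indicator_iff emeasure_eq_measure)
      show "integrable \<nu> (\<lambda>t. f c t * f c t)" by (rule integrable_mult_nu[OF f f])
      fix t
      have "f c t * f c t = (\<Sum>a\<in>A. (c a)\<^sup>2 * (tent L a t)\<^sup>2)"
        unfolding f_def power2_eq_square[symmetric]
        by (intro sum_square_disjoint fin tent_mult_zero L sep)
      moreover have "(c a)\<^sup>2 * indicator {a<..a + L} t \<le> (c a)\<^sup>2 * (tent L a t)\<^sup>2" for a
        using tent_inside[OF L, of t a] by (intro mult_left_mono) (auto simp: indicator_def)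
      ultimately show "(\<Sum>a\<in>A. (c a)\<^sup>2 * indicator {a<..a + L} t) \<le> f c t * f c t"
        by (auto intro: sum_mono)
    qed
    finally show ?thesis .
  qed
  have upper: "(ip (f c) (f c))\<^sup>2 \<le> ip (T (f c)) (f c) * (4 / L * (\<Sum>a\<in>A. (c a)\<^sup>2))" for c
  proof -
    define w where "w = (\<lambda>t. \<Sum>a\<in>A. c a * tent_grad L a t)"
    have w: "is_weak_gradient (f c) w"
      unfolding f_def w_def using A L by (intro is_weak_gradient_sum tent_weak_gradient) auto
    have f1: "f c 1 = 0"
    proof -
      have "tent L a 1 = 0" if "a \<in> A" for a using A[OF that] by (intro tent_outside L) auto
      then show ?thesis by (simp add: f_def)
    qed
    have "(LINT t:{0..1}|lborel. (w t)\<^sup>2) = (LINT t:{0..1}|lborel. (\<Sum>a\<in>A. (c a)\<^sup>2 * (tent_grad L a t)\<^sup>2))"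
      unfolding w_def by (subst sum_square_disjoint[OF fin]) (auto simp: tent_grad_mult_zero L sep)
    also have "\<dots> = (LINT t|lborel. (\<Sum>a\<in>A. (c a)\<^sup>2 * (indicator {0..1} t * (tent_grad L a t)\<^sup>2)))"
      by (simp add: set_lebesgue_integral_def sum_distrib_left mult.left_commute)
    also have "\<dots> = (\<Sum>a\<in>A. (c a)\<^sup>2 * (LINT t:{0..1}|lborel. (tent_grad L a t)\<^sup>2))"
      using tent_grad_L2_unit[OF L]
      by (subst Bochner_Integration.integral_sum)
        (auto simp: L2_unit_def set_integrable_def set_lebesgue_integral_def)
    also have "\<dots> \<le> (\<Sum>a\<in>A. (c a)\<^sup>2 * (4 / L))"
      by (intro sum_mono mult_left_mono tent_energy L) auto
    also have "\<dots> = 4 / L * (\<Sum>a\<in>A. (c a)\<^sup>2)" by (simp add: sum_distrib_left mult.commute)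
    finally show ?thesis
      using ip_square_le_energy[OF f w f1] T_nonneg[OF f] by (meson mult_left_mono order_trans)
  qed
  have xpos: "0 < x" using x L m by (meson divide_pos_pos less_le_trans mult_pos_pos zero_less_numeral)
    have pos: "0 < ip (f c) (f c)" if c: "\<exists>a\<in>A. c a \<noteq> 0" for c
    proof -
      have "0 < (\<Sum>a\<in>A. (c a)\<^sup>2)" using c fin by (auto intro!: sum_pos2)
      then show ?thesis using lower[of c] m by (smt (verit) mult_pos_pos)
    qed
    have large: "ip (f c) (f c) \<le> x * ip (T (f c)) (f c)" for c
    proof (cases "ip (f c) (f c) = 0")
      case True
      then show ?thesis using T_nonneg[OF f] xpos by simp
    next
      case False
      then have pos: "0 < ip (f c) (f c)" using ip_nonneg[of "f c"] by linarith
      have "4 / L * (\<Sum>a\<in>A. (c a)\<^sup>2) \<le> 4 / L * (ip (f c) (f c) / m)"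
        using lower[of c] L m by (intro mult_left_mono) (auto simp: pos_le_divide_eq mult.commute)
      also have "\<dots> = 4 / (L * m) * ip (f c) (f c)" by simp
      also have "\<dots> \<le> x * ip (f c) (f c)" using x pos by (intro mult_right_mono) auto
      finally have "(ip (f c) (f c))\<^sup>2 \<le> ip (T (f c)) (f c) * (x * ip (f c) (f c))"
        using upper[of c] T_nonneg[OF f] by (meson mult_left_mono order_trans)
      then have "ip (f c) (f c) * ip (f c) (f c) \<le> (x * ip (T (f c)) (f c)) * ip (f c) (f c)"
        by (simp add: power2_eq_square mult_ac)
      then show ?thesis using pos by (rule mult_right_le_imp_le)
    qed
  show ?thesis
    by (rule eigenvalue_count_ge[OF fin xpos C0 pos[unfolded f_def] large[unfolded f_def]])
qed

section \<open>Charged dyadic intervals\<close>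

lemma dyadic_interval_inj: "dyadic_interval n j = dyadic_interval n k \<Longrightarrow> j = k"
  by (auto simp: dyadic_interval_def Ioc_inj divide_le_cancel divide_right_mono)

lemma mem_dyadic_interval_iff: "x \<in> dyadic_interval n k \<longleftrightarrow> real k < x * 2 ^ n \<and> x * 2 ^ n \<le> real k + 1"
  by (simp add: dyadic_interval_def divide_less_eq le_divide_eq)

lemma dyadic_interval_disjoint: "j \<noteq> k \<Longrightarrow> dyadic_interval n j \<inter> dyadic_interval n k = {}"
  by (auto simp: mem_dyadic_interval_iff)

lemma dyadic_interval_cover:
  assumes "x \<in> {0<..<1}"
  obtains k where "k < 2 ^ n" "x \<in> dyadic_interval n k"
proof -
  \<comment> \<open>Dyadic intervals are open on the left, hence ceiling minus one rather than
    floor.\<close>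
  define k where "k = nat (\<lceil>x * 2 ^ n\<rceil> - 1)"
  have x: "0 < x * 2 ^ n" "x * 2 ^ n < 2 ^ n" using assms by auto
  then have c: "0 < \<lceil>x * 2 ^ n\<rceil>" by simp
  then have k: "real k = of_int \<lceil>x * 2 ^ n\<rceil> - 1" by (simp add: k_def)
  have "x \<in> dyadic_interval n k"
    unfolding mem_dyadic_interval_iff k using ceiling_correct[of "x * 2 ^ n"] by linarith
  moreover have "real k < 2 ^ n" unfolding k using x ceiling_correct[of "x * 2 ^ n"] by linarith
  then have "k < 2 ^ n" by (metis of_nat_less_iff of_nat_numeral of_nat_power)
  ultimately show ?thesis using that by blast
qed

lemma covering_number_le:
  assumes "finite F" "A \<subseteq> (\<Union>x\<in>F. cball x r)"
  shows "covering_number A r \<le> card F"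
  unfolding covering_number_def using assms by (intro Least_le) auto

lemma covering_number_attained:
  assumes "finite F" "A \<subseteq> (\<Union>x\<in>F. cball x r)"
  obtains F' where "finite F'" "card F' = covering_number A r" "A \<subseteq> (\<Union>x\<in>F'. cball x r)"
proof -
  have "\<exists>n F. finite F \<and> card F = n \<and> A \<subseteq> (\<Union>x\<in>F. cball x r)" using assms by auto
  from LeastI_ex[OF this] show ?thesis using that unfolding covering_number_def by auto
qed

context unit_measure
begin

lemma emeasure_zero_of_AE: "AE x in \<nu>. x \<notin> A \<Longrightarrow> emeasure \<nu> A = 0"
  using emeasure_eq_0_AE[of "\<lambda>x. x \<in> A" \<nu>] by simp

definition charged :: "nat \<Rightarrow> nat set" where
  "charged n = {k. k < 2 ^ n \<and> 0 < measure \<nu> (dyadic_interval n k)}"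

lemma finite_charged [simp]: "finite (charged n)"
  by (rule finite_subset[of _ "{..<2 ^ n}"]) (auto simp: charged_def)

lemma dyadic_interval_sets [simp, measurable]: "dyadic_interval n k \<in> sets borel"
  by (simp add: dyadic_interval_def)

lemma charged_dyadics_eq: "charged_dyadics \<nu> n = dyadic_interval n ` charged n"
  by (auto simp: charged_dyadics_def charged_def)

lemma inj_on_dyadic_interval: "inj_on (dyadic_interval n) (charged n)"
  using dyadic_interval_inj by (auto simp: inj_on_def)

lemma Lq_level_eq: "Lq_level \<nu> n q = ln (\<Sum>k\<in>charged n. measure \<nu> (dyadic_interval n k) powr q) / ln (2 ^ n)"
  by (simp add: Lq_level_def charged_dyadics_eq sum.reindex[OF inj_on_dyadic_interval])

text \<open>The balls form a closed set of full measure, which must contain the support. Closedness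
  matters: the support may contain left endpoints, such as 0, that lie in no charged
  interval.\<close>

lemma support_covered:
  "measure_support \<nu> \<subseteq> (\<Union>z\<in>(\<lambda>k. real k / 2 ^ n) ` charged n. cball z (1 / 2 ^ n))"
proof
  fix x assume x: "x \<in> measure_support \<nu>"
  let ?C = "\<Union>z\<in>(\<lambda>k. real k / 2 ^ n) ` charged n. cball z (1 / 2 ^ n)"
  have "closed ?C" by (intro closed_UN finite_imageI finite_charged) auto
  then have op: "open (- ?C)" by (rule open_Compl)
  show "x \<in> ?C"
  proof (rule ccontr)
    assume "x \<notin> ?C"
    then have "0 < emeasure \<nu> (- ?C)" using x op by (auto simp: measure_support_def)
    moreover have "AE y in \<nu>. y \<in> ?C"
    proof -
      let ?U = "\<Union>k\<in>{..<2 ^ n} - charged n. dyadic_interval n k"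
      have "?U \<in> null_sets \<nu>"
        by (intro null_sets_UN') (auto simp: null_sets_def charged_def emeasure_eq_measure intro: antisym measure_nonneg)
      then have "AE y in \<nu>. y \<notin> ?U" by (rule AE_not_in)
      then show ?thesis
        using AE_unit
      proof eventually_elim
        case (elim y)
        obtain k where k: "k < 2 ^ n" "y \<in> dyadic_interval n k" using dyadic_interval_cover[OF elim(2)] .
        then have "k \<in> charged n" using elim by auto
        moreover have "y \<in> cball (real k / 2 ^ n) (1 / 2 ^ n)"
          using k(2) by (auto simp: dyadic_interval_def dist_real_def add_divide_distrib)
        ultimately show ?case by auto
      qed
    qed
    then have "emeasure \<nu> (- ?C) = 0"
      by (intro emeasure_zero_of_AE) (auto elim!: eventually_mono)
    ultimately show False by simp
  qed
qed

lemma covering_number_le_charged: "covering_number (measure_support \<nu>) (1 / 2 ^ n) \<le> card (charged n)"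
  using covering_number_le[OF _ support_covered] card_image_le[OF finite_charged]
  by (meson finite_charged finite_imageI order_trans)

lemma charged_meets_support:
  assumes "k \<in> charged n"
  shows "\<exists>x \<in> measure_support \<nu>. x \<in> dyadic_interval n k"
proof (rule ccontr)
  assume "\<not> ?thesis"
  then have "AE x in \<nu>. x \<notin> dyadic_interval n k"
    using AE_measure_support[OF sets_nu] by (auto elim!: eventually_mono)
  then have "emeasure \<nu> (dyadic_interval n k) = 0"
    by (rule emeasure_zero_of_AE)
  then show False using assms by (simp add: charged_def measure_def)
qed

lemma card_charged_le: "card (charged n) \<le> 3 * covering_number (measure_support \<nu>) (1 / 2 ^ n)"
proof -
  obtain F where F: "finite F" "card F = covering_number (measure_support \<nu>) (1 / 2 ^ n)"
    "measure_support \<nu> \<subseteq> (\<Union>x\<in>F. cball x (1 / 2 ^ n))"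
    using covering_number_attained[OF _ support_covered] by (metis finite_charged finite_imageI)
  \<comment> \<open>With \<open>w = z * 2 ^ n\<close>, an interval containing a point of the ball
    around \<open>z\<close> has \<open>w - 2 <= k < w + 1\<close>, which leaves three integers; this
    is the factor 3.\<close>
  define G where "G = (\<lambda>z::real. nat ` {\<lceil>z * 2 ^ n\<rceil> - 2..\<lceil>z * 2 ^ n\<rceil>})"
  have "charged n \<subseteq> (\<Union>z\<in>F. G z)"
  proof
    fix k assume "k \<in> charged n"
    then obtain x where x: "x \<in> measure_support \<nu>" "x \<in> dyadic_interval n k"
      using charged_meets_support by blast
    then obtain z where z: "z \<in> F" "\<bar>z - x\<bar> \<le> 1 / 2 ^ n" using F(3) by (auto simp: dist_real_def)
    then have "\<bar>z - x\<bar> * 2 ^ n \<le> 1" by (simp add: le_divide_eq)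
    then have "\<bar>z * 2 ^ n - x * 2 ^ n\<bar> \<le> 1" by (simp add: left_diff_distrib[symmetric] abs_mult)
    then have "z * 2 ^ n - 2 \<le> of_int (int k)" "of_int (int k) < z * 2 ^ n + 1"
      using x(2) by (auto simp: mem_dyadic_interval_iff)
    then have "\<lceil>z * 2 ^ n\<rceil> - 2 \<le> int k" "int k \<le> \<lceil>z * 2 ^ n\<rceil>"
      by linarith+
    then have "nat (int k) \<in> G z" unfolding G_def by (intro imageI) auto
    then show "k \<in> (\<Union>z\<in>F. G z)" using z by auto
  qed
  then have "card (charged n) \<le> card (\<Union>z\<in>F. G z)"
    using F(1) by (intro card_mono) (auto simp: G_def)
  also have "\<dots> \<le> (\<Sum>z\<in>F. card (G z))" by (rule card_UN_le[OF F(1)])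
  also have "\<dots> \<le> (\<Sum>z\<in>F. 3)"
  proof (rule sum_mono)
    fix z
    have "card (G z) \<le> card {\<lceil>z * 2 ^ n\<rceil> - 2..\<lceil>z * 2 ^ n\<rceil>}"
      unfolding G_def by (rule card_image_le) simp
    then show "card (G z) \<le> 3" by simp
  qed
  finally show ?thesis using F(2) by simp
qed

lemma sum_charged_le: "(\<Sum>k\<in>charged n. measure \<nu> (dyadic_interval n k)) \<le> mass"
proof -
  have "(\<Sum>k\<in>charged n. measure \<nu> (dyadic_interval n k)) = measure \<nu> (\<Union>k\<in>charged n. dyadic_interval n k)"
    using dyadic_interval_disjoint
    by (intro finite_measure_finite_Union[symmetric]) (auto simp: disjoint_family_on_def)
  also have "\<dots> \<le> mass" using bounded_measure by simp
  finally show ?thesis .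
qed

text \<open>Disjoint intervals share the total mass, so the level sums stay bounded. The value at 1
  will force \<open>b\<close> to be nonnegative.\<close>

lemma Lq_spectrum_one_le: "Lq_spectrum \<nu> 1 \<le> 0"
proof -
  let ?K = "ln (max 1 mass)"
  have K: "0 \<le> ?K" by simp
  have "Lq_level \<nu> n 1 \<le> ?K / ln (2 ^ n)" for n
  proof -
    let ?s = "\<Sum>k\<in>charged n. measure \<nu> (dyadic_interval n k)"
    have s: "(\<Sum>k\<in>charged n. measure \<nu> (dyadic_interval n k) powr 1) = ?s"
      by (intro sum.cong) (auto simp: measure_nonneg)
    have "ln ?s \<le> ?K"
    proof (cases "?s \<le> 0")
      case True
      then have "?s = 0" by (intro antisym sum_nonneg) auto
      then show ?thesis using K by simp
    next
      case False
      then show ?thesis using sum_charged_le[of n] by (intro ln_mono) auto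
    qed
    then show ?thesis unfolding Lq_level_eq s by (intro divide_right_mono) auto
  qed
  then have "Lq_spectrum \<nu> 1 \<le> limsup (\<lambda>n. ereal (?K / ln (2 ^ n)))"
    unfolding Lq_spectrum_def by (intro Limsup_mono always_eventually) auto
  also have "(\<lambda>n. ?K / ln (2 ^ n)) \<longlonglongrightarrow> 0"
  proof -
    have "(\<lambda>n. (?K / ln 2) * inverse (real n)) \<longlonglongrightarrow> (?K / ln 2) * 0"
      by (intro tendsto_intros lim_inverse_n)
    then show ?thesis by (simp add: ln_realpow divide_inverse mult_ac)
  qed
  then have "limsup (\<lambda>n. ereal (?K / ln (2 ^ n))) = ereal 0"
    by (intro lim_imp_Limsup) auto
  finally show ?thesis by (simp only: zero_ereal_def)
qed

end

lemma filterlim_inverse_two_power: "filterlim (\<lambda>n. 1 / 2 ^ n :: real) (at_right 0) sequentially"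
proof (rule tendsto_imp_filterlim_at_right)
  show "(\<lambda>n. 1 / 2 ^ n :: real) \<longlonglongrightarrow> 0"
    using LIMSEQ_power_zero[of "1/2 :: real"] by (simp add: power_one_over)
qed auto

context unit_measure
begin

section \<open>Numbers of charged, light and heavy intervals\<close>

text \<open>The number of charged intervals and the covering number at the same scale differ by at
  most a factor 3, negligible after division by \<open>ln (2 ^ n)\<close>. The limit is a real
  number because a level has only \<open>2 ^ n\<close> intervals.\<close>

lemma card_charged_asymp:
  assumes nz: "emeasure \<nu> {0<..<1} \<noteq> 0"
    and mink: "upper_minkowski_dim (measure_support \<nu>) = lower_minkowski_dim (measure_support \<nu>)"
  obtains d where "0 \<le> d" "upper_minkowski_dim (measure_support \<nu>) = ereal d"
    "(\<lambda>n. ln (real (card (charged n))) / ln (2 ^ n)) \<longlonglongrightarrow> d" "\<And>n. 0 < card (charged n)"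
proof -
  let ?K = "measure_support \<nu>"
  let ?cov = "\<lambda>n::nat. covering_number ?K (1 / 2 ^ n)"
  define c where "c = (\<lambda>n. ln (real (?cov n)) / ln (2 ^ n))"
  define q where "q = (\<lambda>n. ln (real (card (charged n))) / ln (2 ^ n))"
  have pos: "0 < card (charged n)" for n
  proof (rule ccontr)
    assume "\<not> 0 < card (charged n)"
    then have "?K = {}" using support_covered[of n] by auto
    then have "AE x in \<nu>. False" using AE_measure_support[OF sets_nu] by simp
    then have "emeasure \<nu> {0<..<1} = 0" by (intro emeasure_zero_of_AE) (auto elim!: eventually_mono)
    then show False using nz by simp
  qed
  have covpos: "0 < ?cov n" for n using card_charged_le[of n] pos[of n] by (cases "?cov n") auto
  have q_le: "q n \<le> 1" for n
  proof -
    have "card (charged n) \<le> card {..<2 ^ n :: nat}"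
      by (intro card_mono) (auto simp: charged_def)
    then have "real (card (charged n)) \<le> 2 ^ n" by (simp add: of_nat_le_iff[symmetric] del: of_nat_le_iff)
    then have "ln (real (card (charged n))) \<le> ln (2 ^ n)" using pos[of n] by (intro ln_mono) auto
    then show ?thesis by (cases "n = 0") (auto simp: q_def divide_le_eq)
  qed
  have c_q: "c n \<le> q n" for n
    unfolding c_def q_def using covering_number_le_charged[of n] covpos[of n] pos[of n]
    by (intro divide_right_mono ln_mono) auto
  have q_c: "q n \<le> c n + ln 3 / ln (2 ^ n)" for n
  proof -
    have "real (card (charged n)) \<le> 3 * real (?cov n)" using card_charged_le[of n] by linarith
    then have "ln (real (card (charged n))) \<le> ln (3 * real (?cov n))"
      using pos[of n] by (intro ln_mono) auto
    also have "\<dots> = ln 3 + ln (real (?cov n))" using covpos[of n] by (subst ln_mult) auto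
    finally have "q n \<le> (ln 3 + ln (real (?cov n))) / ln (2 ^ n)"
      unfolding q_def by (intro divide_right_mono) auto
    then show ?thesis by (simp add: c_def add_divide_distrib)
  qed
  have c_nonneg: "0 \<le> c n" for n unfolding c_def using covpos[of n] by (intro divide_nonneg_nonneg) auto
  define \<delta> where "\<delta> = upper_minkowski_dim ?K"
  have "((\<lambda>r. ereal (ln (real (covering_number ?K r)) / ln (1 / r))) \<longlongrightarrow> \<delta>) (at_right 0)"
    using mink by (subst tendsto_iff_Liminf_eq_Limsup)
      (auto simp: \<delta>_def upper_minkowski_dim_def lower_minkowski_dim_def)
  from filterlim_compose[OF this filterlim_inverse_two_power]
  have lim: "(\<lambda>n. ereal (c n)) \<longlonglongrightarrow> \<delta>" by (simp add: c_def)
  have "0 \<le> \<delta>" using lim c_nonneg by (intro LIMSEQ_le_const) auto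
  moreover have "\<delta> \<le> 1"
  proof (rule LIMSEQ_le_const2[OF lim])
    have "c n \<le> 1" for n using c_q[of n] q_le[of n] by linarith
    then show "\<exists>N. \<forall>n\<ge>N. ereal (c n) \<le> 1" by simp
  qed
  ultimately obtain d where d: "\<delta> = ereal d" "0 \<le> d" by (cases \<delta>) auto
  have cd: "c \<longlonglongrightarrow> d" using lim by (simp add: d)
  have "(\<lambda>n. c n + (ln 3 / ln 2) * inverse (real n)) \<longlonglongrightarrow> d + (ln 3 / ln 2) * 0"
    by (intro tendsto_intros cd lim_inverse_n)
  then have ub: "(\<lambda>n. c n + ln 3 / ln (2 ^ n)) \<longlonglongrightarrow> d"
    by (simp add: ln_realpow divide_inverse mult_ac)
  have "q \<longlonglongrightarrow> d"
    by (rule tendsto_sandwich[OF _ _ cd ub]) (auto simp: c_q q_c)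
  then show ?thesis using that[of d] d pos by (simp add: \<delta>_def q_def[symmetric])
qed

lemma Lq_spectrum_zero_eq:
  assumes "(\<lambda>n. ln (real (card (charged n))) / ln (2 ^ n)) \<longlonglongrightarrow> d"
  shows "Lq_spectrum \<nu> 0 = ereal d"
proof -
  have "(\<Sum>k\<in>charged n. measure \<nu> (dyadic_interval n k) powr 0) = real (card (charged n))" for n
    by (simp add: charged_def)
  then have "Lq_level \<nu> n 0 = ln (real (card (charged n))) / ln (2 ^ n)" for n
    by (simp only: Lq_level_eq)
  then show ?thesis
    unfolding Lq_spectrum_def using assms by (intro lim_imp_Limsup) auto
qed

text \<open>Since \<open>- s\<close> is not a subgradient at \<open>0\<close> for \<open>s > b\<close>, Markov's inequality at a negative \<open>t\<close> with
  \<open>\<beta> t < d - s t\<close> shows that intervals of mass below \<open>2\<^sup>-\<^sup>n\<^sup>s\<close> are exponentially rare.\<close>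

lemma light_intervals_rare:
  assumes d: "Lq_spectrum \<nu> 0 = ereal d"
    and sub: "uminus ` subdifferential (Lq_spectrum \<nu>) 0 = {a..b}" "a \<le> b"
    and s: "b < s"
  obtains \<eta> where "0 < \<eta>"
    "\<forall>\<^sub>F n in sequentially. real (card {k \<in> charged n. measure \<nu> (dyadic_interval n k) < 2 powr (- (real n * s))})
      \<le> 2 powr (real n * (d - \<eta>))"
proof -
  have "- s \<notin> subdifferential (Lq_spectrum \<nu>) 0"
  proof
    assume "- s \<in> subdifferential (Lq_spectrum \<nu>) 0"
    then have "s \<in> uminus ` subdifferential (Lq_spectrum \<nu>) 0" by force
    then show False using sub s by auto
  qed
  then obtain t where t: "Lq_spectrum \<nu> t < ereal (- s * t + d)"
    by (auto simp: subdifferential_def d not_le)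
  have "b \<in> uminus ` subdifferential (Lq_spectrum \<nu>) 0" using sub by simp
  then have "- b \<in> subdifferential (Lq_spectrum \<nu>) 0" by force
  then have "ereal (- b * t + d) \<le> Lq_spectrum \<nu> t"
    by (auto simp: subdifferential_def d)
  \<comment> \<open>The line of slope \<open>- b\<close> through \<open>(0, d)\<close> lies below
    the spectrum and the one of slope \<open>- s\<close> fails to at \<open>t\<close>; comparing
    both at \<open>t\<close> gives its sign.\<close>
  then have "ereal (- b * t + d) < ereal (- s * t + d)" using t by (rule le_less_trans)
  then have "0 < (s - b) * (- t)" by (simp add: algebra_simps)
  then have tneg: "t < 0" using s by (simp add: zero_less_mult_iff mult_less_0_iff)
  obtain y where y: "Lq_spectrum \<nu> t < ereal y" "y < - s * t + d"
    using ereal_dense2[OF t] by auto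
  \<comment> \<open>The gap between the violated line and an intermediate value \<open>y\<close>
    becomes the exponential gain over \<open>2 powr (n * d)\<close>.\<close>
  define \<eta> where "\<eta> = - s * t + d - y"
  have ev: "\<forall>\<^sub>F n in sequentially. Lq_level \<nu> n t < y"
    using Limsup_lessD[OF y(1)[unfolded Lq_spectrum_def]] by simp
  have *: "real (card {k \<in> charged n. measure \<nu> (dyadic_interval n k) < 2 powr (- (real n * s))})
      \<le> 2 powr (real n * (d - \<eta>))"
    if n: "Lq_level \<nu> n t < y" "1 \<le> n" for n
  proof -
    let ?m = "\<lambda>k. measure \<nu> (dyadic_interval n k)"
    let ?B = "{k \<in> charged n. ?m k < 2 powr (- (real n * s))}"
    let ?S = "\<Sum>k\<in>charged n. ?m k powr t"
    show ?thesis
    proof (cases "?B = {}")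
      case True
      then show ?thesis by (simp only: card.empty) simp
    next
      case False
      then have "0 < ?S" by (intro sum_pos) (auto simp: charged_def)
      moreover have "ln ?S < y * ln (2 ^ n)"
        using n by (simp add: Lq_level_eq pos_divide_less_eq)
      ultimately have S: "?S < 2 powr (real n * y)"
        by (subst ln_less_cancel_iff[symmetric]) (auto simp: ln_powr ln_realpow mult_ac)
      have "real (card ?B) * 2 powr (- (real n * s) * t) = (\<Sum>k\<in>?B. (2 powr (- (real n * s))) powr t)"
        by (simp add: powr_powr)
      also have "\<dots> \<le> (\<Sum>k\<in>?B. ?m k powr t)"
        using tneg by (intro sum_mono powr_mono2') (auto simp: charged_def)
      also have "\<dots> \<le> ?S" by (intro sum_mono2) auto
      finally have "real (card ?B) * 2 powr (- (real n * s) * t) < 2 powr (real n * y)" using S by linarith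
      then have "real (card ?B) < 2 powr (real n * y) / 2 powr (- (real n * s) * t)"
        by (simp add: pos_less_divide_eq)
      also have "\<dots> = 2 powr (real n * (d - \<eta>))"
        by (simp add: powr_diff[symmetric] \<eta>_def algebra_simps)
      finally show ?thesis by simp
    qed
  qed
  have "\<forall>\<^sub>F n in sequentially. real (card {k \<in> charged n. measure \<nu> (dyadic_interval n k) < 2 powr (- (real n * s))})
      \<le> 2 powr (real n * (d - \<eta>))"
    using ev eventually_ge_at_top[of 1] by eventually_elim (rule *)
  moreover have "0 < \<eta>" using y by (simp add: \<eta>_def)
  ultimately show ?thesis using that by blast
qed

text \<open>Light intervals are exponentially fewer than charged ones. The two extreme intervals are
  dropped to leave room in [0,1] for the flanks of the tents, and one parity class is kept since
  equal parity means a distance of at least two interval lengths.\<close>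

lemma many_separated_heavy_intervals:
  assumes lim: "(\<lambda>n. ln (real (card (charged n))) / ln (2 ^ n)) \<longlonglongrightarrow> d"
    and pos: "\<And>n. 0 < card (charged n)"
    and sub: "uminus ` subdifferential (Lq_spectrum \<nu>) 0 = {a..b}" "a \<le> b"
    and s: "b < s" and th: "0 \<le> th" "th < d"
  shows "\<forall>\<^sub>F n in sequentially. \<exists>A. finite A \<and> 2 powr (real n * th) \<le> real (card A) \<and>
    (\<forall>k\<in>A. 1 \<le> k \<and> k + 2 \<le> 2 ^ n \<and> 2 powr (- (real n * s)) \<le> measure \<nu> (dyadic_interval n k)) \<and>
    (\<forall>j\<in>A. \<forall>k\<in>A. even j = even k)"
proof -
  obtain \<eta> where \<eta>: "0 < \<eta>"
    "\<forall>\<^sub>F n in sequentially. real (card {k \<in> charged n. measure \<nu> (dyadic_interval n k) < 2 powr (- (real n * s))})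
      \<le> 2 powr (real n * (d - \<eta>))"
    using light_intervals_rare[OF Lq_spectrum_zero_eq[OF lim] sub s] by blast
  \<comment> \<open>\<open>u\<close> dominates the wanted exponent and that of the light intervals;
    \<open>v\<close> leaves a margin on both sides between \<open>u\<close> and
    \<open>d\<close>.\<close>
  define u where "u = max th (d - \<eta>)"
  have u: "0 \<le> u" "u < d" using th \<eta>(1) by (auto simp: u_def)
  define v where "v = (u + d) / 2"
  have v: "u < v" "v < d" using u by (auto simp: v_def)
  have ev1: "\<forall>\<^sub>F n in sequentially. v < ln (real (card (charged n))) / ln (2 ^ n)"
    using order_tendstoD(1)[OF lim v(2)] .
  \<comment> \<open>The 5 is spent below, in units of \<open>p >= 1\<close>: one for the light
    intervals, two for the two extreme ones, and two so that a parity class still has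
    \<open>p\<close> members.\<close>
  have ev2: "\<forall>\<^sub>F n in sequentially. 5 \<le> 2 powr (real n * (v - u))"
    using eventually_ge_at_top[of "nat \<lceil>3 / (v - u)\<rceil>"]
  proof eventually_elim
    case (elim n)
    then have "3 / (v - u) \<le> real n" by linarith
    then have "3 \<le> real n * (v - u)" using v by (simp add: pos_divide_le_eq)
    then have "2 powr 3 \<le> 2 powr (real n * (v - u))" by (intro powr_mono) auto
    moreover have "(2::real) powr 3 = 8" by simp
    ultimately show ?case by linarith
  qed
  show ?thesis
    using ev1 ev2 \<eta>(2) eventually_ge_at_top[of 1]
  proof eventually_elim
    case (elim n)
    let ?m = "\<lambda>k. measure \<nu> (dyadic_interval n k)"
    let ?B = "{k \<in> charged n. ?m k < 2 powr (- (real n * s))}"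
    define G where "G = charged n - ?B - {0, 2 ^ n - 1}"
    define p where "p = 2 powr (real n * u)"
    have p: "1 \<le> p" "2 powr (real n * th) \<le> p" "2 powr (real n * (d - \<eta>)) \<le> p"
      using u by (auto simp: p_def u_def ge_one_powr_ge_zero intro!: mult_left_mono)
    have "v * ln (2 ^ n) < ln (real (card (charged n)))"
      using elim by (simp add: pos_less_divide_eq)
    then have "2 powr (real n * v) < real (card (charged n))"
      using pos[of n] by (subst ln_less_cancel_iff[symmetric]) (auto simp: ln_powr ln_realpow mult_ac)
    moreover have "2 powr (real n * v) = p * 2 powr (real n * (v - u))"
      by (simp add: p_def powr_add[symmetric] algebra_simps)
    moreover have "p * 5 \<le> p * 2 powr (real n * (v - u))" using p elim by (intro mult_left_mono) auto
    ultimately have many: "5 * p \<le> real (card (charged n))" by linarith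
    have "charged n \<subseteq> G \<union> ?B \<union> {0, 2 ^ n - 1}" by (auto simp: G_def)
    then have "card (charged n) \<le> card (G \<union> ?B \<union> {0, 2 ^ n - 1})"
      by (intro card_mono) (auto simp: G_def)
    also have "\<dots> \<le> card G + card ?B + card {0, 2 ^ n - 1 :: nat}"
      using card_Un_le[of "G \<union> ?B" "{0, 2 ^ n - 1}"] card_Un_le[of G ?B] by linarith
    also have "card {0, 2 ^ n - 1 :: nat} \<le> 2" by (simp add: card_insert_if)
    finally have "real (card (charged n)) \<le> real (card G) + real (card ?B) + 2" by linarith
    then have G2: "2 * p \<le> real (card G)" using many elim(3) p by linarith
    have "G = {k \<in> G. even k} \<union> {k \<in> G. odd k}" by auto
    then have "card G \<le> card {k \<in> G. even k} + card {k \<in> G. odd k}" by (metis card_Un_le)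
    then have "p \<le> real (card {k \<in> G. even k}) \<or> p \<le> real (card {k \<in> G. odd k})" using G2 by linarith
    moreover have "1 \<le> k \<and> k + 2 \<le> 2 ^ n \<and> 2 powr (- (real n * s)) \<le> ?m k" if "k \<in> G" for k
      using that by (auto simp: G_def charged_def not_less)
    moreover have "finite G" by (simp add: G_def)
    ultimately show ?case
      using p(2) by (elim disjE; intro exI[of _ "{k \<in> G. even k}"] exI[of _ "{k \<in> G. odd k}"]) 
        (auto intro: order_trans)
  qed
qed

text \<open>Tents with \<open>L\<close> equal to \<open>1 / 2 ^ n\<close> and mass threshold
  \<open>2 powr (- (n * s))\<close> turn \<open>4 / (L * m)\<close> into the bound on
  \<open>x\<close>.\<close>

lemma eigenvalue_count_ge_dyadic:
  assumes A: "finite A" "\<And>j k. j \<in> A \<Longrightarrow> k \<in> A \<Longrightarrow> even j = even k"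
    "\<And>k. k \<in> A \<Longrightarrow> 1 \<le> k \<and> k + 2 \<le> 2 ^ n \<and> 2 powr (- (real n * s)) \<le> measure \<nu> (dyadic_interval n k)"
    and x: "4 * 2 powr (real n * (1 + s)) \<le> x"
  shows "card A \<le> eigenvalue_count \<nu> x"
proof -
  let ?L = "1 / 2 ^ n :: real" and ?m = "2 powr (- (real n * s))" and ?g = "\<lambda>k. real k / 2 ^ n"
  have inj: "inj_on ?g A" by (auto simp: inj_on_def)
  have "card (?g ` A) \<le> eigenvalue_count \<nu> x"
  proof (rule eigenvalue_count_ge_card_intervals)
    show "finite (?g ` A)" "0 < ?L" "0 < ?m" using A(1) by auto
    have "1 / (?L * ?m) = 2 powr (real n * (1 + s))"
      by (simp add: powr_minus powr_add powr_realpow divide_inverse algebra_simps)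
    then show "4 / (?L * ?m) \<le> x" using x by (simp add: field_simps)
  next
    fix a assume "a \<in> ?g ` A"
    then obtain k where k: "k \<in> A" "a = ?g k" by auto
    have "real k + 2 \<le> 2 ^ n"
      using A(3)[OF k(1)] by (metis of_nat_add of_nat_le_iff of_nat_numeral of_nat_power)
    moreover have "1 \<le> real k" using A(3)[OF k(1)] by simp
    ultimately show "0 \<le> a - ?L / 2 \<and> a + 3 * ?L / 2 \<le> 1"
      using k(2) by (auto simp: field_simps)
    have "{a<..a + ?L} = dyadic_interval n k" by (simp add: k dyadic_interval_def add_divide_distrib)
    then show "?m \<le> measure \<nu> {a<..a + ?L}" using A(3)[OF k(1)] by simp
  next
    fix a b assume ab: "a \<in> ?g ` A" "b \<in> ?g ` A" "a \<noteq> b"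
    then obtain j k where jk: "j \<in> A" "a = ?g j" "k \<in> A" "b = ?g k" by blast
    have "even j = even k" using A(2) jk by blast
    moreover have "j \<noteq> k" using jk ab by auto
    ultimately have "2 \<le> \<bar>int j - int k\<bar>" by presburger
    then have "2 \<le> \<bar>real j - real k\<bar>" by linarith
    then have "2 / 2 ^ n \<le> \<bar>real j - real k\<bar> / 2 ^ n" by (intro divide_right_mono) auto
    then show "2 * ?L \<le> \<bar>a - b\<bar>" by (simp add: jk diff_divide_distrib[symmetric])
  qed
  then show ?thesis by (simp add: card_image[OF inj])
qed

section \<open>From dyadic levels to all \<open>x\<close>\<close>

lemma lower_spectral_dim_ge:
  assumes lim: "(\<lambda>n. ln (real (card (charged n))) / ln (2 ^ n)) \<longlonglongrightarrow> d"
    and pos: "\<And>n. 0 < card (charged n)"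
    and sub: "uminus ` subdifferential (Lq_spectrum \<nu>) 0 = {a..b}" "a \<le> b"
    and s: "b < s" "0 < s" and th: "0 \<le> th" "th < d"
  shows "ereal (th / (1 + s)) \<le> lower_spectral_dim \<nu>"
proof -
  obtain n0 where n0: "\<And>n. n \<ge> n0 \<Longrightarrow> \<exists>A. finite A \<and> 2 powr (real n * th) \<le> real (card A) \<and>
    (\<forall>k\<in>A. 1 \<le> k \<and> k + 2 \<le> 2 ^ n \<and> 2 powr (- (real n * s)) \<le> measure \<nu> (dyadic_interval n k)) \<and>
    (\<forall>j\<in>A. \<forall>k\<in>A. even j = even k)"
    using many_separated_heavy_intervals[OF lim pos sub s(1) th] by (auto simp: eventually_sequentially)
  have count: "2 powr (real n * th) \<le> real (eigenvalue_count \<nu> x)"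
    if n: "n \<ge> n0" and x: "4 * 2 powr (real n * (1 + s)) \<le> x" for n x
  proof -
    obtain A where "finite A" "2 powr (real n * th) \<le> real (card A)"
      "\<forall>k\<in>A. 1 \<le> k \<and> k + 2 \<le> 2 ^ n \<and> 2 powr (- (real n * s)) \<le> measure \<nu> (dyadic_interval n k)"
      "\<forall>j\<in>A. \<forall>k\<in>A. even j = even k" using n0[OF n] by blast
    moreover from this have "card A \<le> eigenvalue_count \<nu> x"
      by (intro eigenvalue_count_ge_dyadic[OF _ _ _ x]) blast+
    ultimately show ?thesis by linarith
  qed
  \<comment> \<open>\<open>C\<close> pays for the factor 4 in the threshold and for rounding the
    real level \<open>y\<close> down to an integer; it is negligible against
    \<open>ln x\<close>.\<close>
  define C where "C = th * (ln 4 / (1 + s) + ln 2)"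
  have "\<forall>\<^sub>F x in at_top. th / (1 + s) - C / ln x \<le> ln (real (eigenvalue_count \<nu> x)) / ln x"
    using eventually_ge_at_top[of "4 * 2 powr (real n0 * (1 + s))"]
  proof eventually_elim
    case (elim x)
    have "(1::real) \<le> 2 powr (real n0 * (1 + s))" using s by (intro ge_one_powr_ge_zero) auto
    then have x4: "4 \<le> x" using elim by linarith
    define y where "y = log 2 (x / 4) / (1 + s)"
    define n where "n = nat \<lfloor>y\<rfloor>"
    have "log 2 (2 powr (real n0 * (1 + s))) \<le> log 2 (x / 4)"
      using elim x4 by (subst log_le_cancel_iff) auto
    then have y0: "real n0 \<le> y" using s by (simp add: y_def pos_le_divide_eq)
    then have n: "real n \<le> y" "y - 1 \<le> real n" "n0 \<le> n" unfolding n_def by linarith+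
    have "real n * (1 + s) \<le> log 2 (x / 4)" using n(1) s by (simp add: y_def pos_le_divide_eq)
    then have "2 powr (real n * (1 + s)) \<le> 2 powr (log 2 (x / 4))" by (intro powr_mono) auto
    also have "\<dots> = x / 4" using x4 by (intro powr_log_cancel) auto
    finally have c: "2 powr (real n * th) \<le> real (eigenvalue_count \<nu> x)"
      using n(3) by (intro count) auto
    have lnx: "0 < ln x" using x4 by simp
    have "y * ln 2 = (ln x - ln 4) / (1 + s)"
      using x4 by (simp add: y_def log_def ln_div)
    then have "(y - 1) * ln 2 = (ln x - ln 4) / (1 + s) - ln 2" by (simp add: left_diff_distrib)
    then have "th / (1 + s) * ln x - C = th * ((y - 1) * ln 2)"
      by (simp only: C_def) (simp add: algebra_simps diff_divide_distrib)
    also have "\<dots> \<le> th * (real n * ln 2)"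
      using n(2) th by (intro mult_left_mono mult_right_mono) auto
    also have "\<dots> = ln (2 powr (real n * th))" by (simp add: ln_powr)
    also have "\<dots> \<le> ln (real (eigenvalue_count \<nu> x))" using c by (intro ln_mono) auto
    finally have "(th / (1 + s) * ln x - C) / ln x \<le> ln (real (eigenvalue_count \<nu> x)) / ln x"
      using lnx by (intro divide_right_mono) auto
    then show ?case using lnx by (simp add: diff_divide_distrib)
  qed
  then have "Liminf at_top (\<lambda>x. ereal (th / (1 + s) - C / ln x)) \<le> lower_spectral_dim \<nu>"
    unfolding lower_spectral_dim_def by (intro Liminf_mono) (auto elim!: eventually_mono)
  moreover have "((\<lambda>x. C / ln x) \<longlongrightarrow> 0) at_top"
    by (intro tendsto_divide_0[OF tendsto_const] filterlim_at_top_imp_at_infinity ln_at_top)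
  then have "((\<lambda>x. th / (1 + s) - C / ln x) \<longlongrightarrow> th / (1 + s)) at_top"
    using tendsto_diff[OF tendsto_const, of _ 0 at_top "th / (1 + s)"] by simp
  then have "Liminf at_top (\<lambda>x. ereal (th / (1 + s) - C / ln x)) = ereal (th / (1 + s))"
    by (intro lim_imp_Liminf) auto
  ultimately show ?thesis by simp
qed

text \<open>Settles dimension 0, where no exponent \<open>0 <= th < d\<close> exists. The default
  \<open>ln 0 = 0\<close> makes an empty count harmless.\<close>

lemma lower_spectral_dim_nonneg: "0 \<le> lower_spectral_dim \<nu>"
  unfolding lower_spectral_dim_def
proof (rule Liminf_bounded)
  show "\<forall>\<^sub>F x in at_top. 0 \<le> ereal (ln (real (eigenvalue_count \<nu> x)) / ln x)"
    using eventually_ge_at_top[of 1]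
  proof eventually_elim
    case (elim x)
    have "0 \<le> ln (real (eigenvalue_count \<nu> x))"
      by (cases "eigenvalue_count \<nu> x") auto
    then show ?case using elim by simp
  qed
qed

end

theorem corollary1p11:
  fixes \<nu> :: "real measure" and a b :: real
  assumes "finite_measure \<nu>"
    and "borel_measure_on_unit \<nu>"
    and "emeasure \<nu> {0<..<1} \<noteq> 0"
    and "upper_minkowski_dim (measure_support \<nu>) = lower_minkowski_dim (measure_support \<nu>)"
    and "a \<le> b"
    and "uminus ` subdifferential (Lq_spectrum \<nu>) 0 = {a..b}"
  shows "upper_minkowski_dim (measure_support \<nu>) / ereal (1 + b) \<le> lower_spectral_dim \<nu>"
proof -
  interpret unit_measure \<nu>
    using assms(1,2) by (simp add: unit_measure_def unit_measure_axioms_def)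
  obtain d where d: "0 \<le> d" "upper_minkowski_dim (measure_support \<nu>) = ereal d"
    and lim: "(\<lambda>n. ln (real (card (charged n))) / ln (2 ^ n)) \<longlonglongrightarrow> d"
    and pos: "\<And>n. 0 < card (charged n)"
    using card_charged_asymp[OF assms(3,4)] by blast
  have "b \<in> uminus ` subdifferential (Lq_spectrum \<nu>) 0" using assms(5,6) by simp
  then have "- b \<in> subdifferential (Lq_spectrum \<nu>) 0" by force
  \<comment> \<open>The subgradient inequality at 1 gives \<open>d - b <= 0\<close>, so
    \<open>1 + b\<close> is positive.\<close>
  then have "ereal (- b * (1 - 0)) + Lq_spectrum \<nu> 0 \<le> Lq_spectrum \<nu> 1"
    unfolding subdifferential_def by blast
  then have "ereal (- b + d) \<le> Lq_spectrum \<nu> 1" by (simp add: Lq_spectrum_zero_eq[OF lim])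
  also have "\<dots> \<le> 0" by (rule Lq_spectrum_one_le)
  finally have b: "0 \<le> b" using d(1) by simp
  have div: "ereal d / ereal (1 + b) = ereal (d / (1 + b))" using b by simp
  show ?thesis
  proof (cases "d = 0")
    case True
    then show ?thesis using lower_spectral_dim_nonneg by (simp add: d zero_ereal_def[symmetric])
  next
    case False
    then have dpos: "0 < d" using d by simp
    \<comment> \<open>\<open>d * (1 - e n)\<close> and \<open>b + e n\<close> meet the strict bounds
      on \<open>th\<close> and \<open>s\<close>; \<open>e n <= 1\<close> keeps the former
      nonnegative, and the limit closes the gap.\<close>
    define e where "e = (\<lambda>n. inverse (real (Suc n)))"
    have e: "e \<longlonglongrightarrow> 0" "\<And>n. 0 < e n" "\<And>n. e n \<le> 1"
      unfolding e_def using LIMSEQ_inverse_real_of_nat by (auto simp: field_simps)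
    have "(\<lambda>n. d * (1 - e n) / (1 + (b + e n))) \<longlonglongrightarrow> d * (1 - 0) / (1 + (b + 0))"
      using b by (intro tendsto_intros e) auto
    then have lim_e: "(\<lambda>n. ereal (d * (1 - e n) / (1 + (b + e n)))) \<longlonglongrightarrow> ereal (d / (1 + b))" by simp
    have "ereal (d * (1 - e n) / (1 + (b + e n))) \<le> lower_spectral_dim \<nu>" for n
      using e(2)[of n] e(3)[of n] dpos b
      by (intro lower_spectral_dim_ge[OF lim pos assms(6,5)]) (auto simp: algebra_simps)
    then have "ereal (d / (1 + b)) \<le> lower_spectral_dim \<nu>"
      by (intro LIMSEQ_le_const2[OF lim_e]) blast
    then show ?thesis by (simp only: d(2) div)
  qed
qed

end
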